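(* Let $L\in\{1,\infty\}$ and let $E$ be an arbitrary rearrangement-invariant quasi-Banach function space on $(0,L)$. Then there exist $p_0$ and $p_1$ such that $0<p_0<p_1\le\infty$ and $$\left(L_{p_0}(0,L),L_{p_1}(0,L)\right)_{\Theta,p_0;E}=E,\qquad\text{where}\quad \frac1\Theta=\frac1{p_0}-\frac1{p_1}.$$ In addition, there exists $p_0$ such that $0<p_0<\infty$ and $$\left(L_{p_0}(0,L),L_\infty(0,L)\right)_{p_0,p_0;E}=E.$$ Here equality of spaces means that they coincide as sets and their quasi-norms are equivalent.
   Context: Conventions: $1/\infty=0$. $\mathfrak M(0,L)$ is the set of complex-valued Lebesgue measurable, a.e. finite functions on $(0,L)$, with a.e. equal functions identified. The non-increasing rearrangement of $f$ is $f^*(t)=\inf\{\lambda>0:\ |\{x\in(0,L):|f(x)|>\lambda\}|\le t\}$, $t>0$. $L_p(0,L)$, $0<p\le\infty$, is the usual Lebesgue space with its usual (quasi-)norm. A quasi-norm is a map satisfying the norm axioms except that the triangle inequality is replaced by $\|x+y\|\le C(\|x\|+\|y\|)$ with a constant $C\ge1$. Rearrangement-invariant (r.i.) quasi-Banach function space on $(0,L)$: a quasi-Banach space $E\subset\mathfrak M(0,L)$ for which there is $\rho_E:\mathfrak M(0,L)\to[0,\infty]$ such that (P1) $\rho_E$ is a quasi-norm (possibly taking the value $\infty$); (P2) $|g|\le|f|$ a.e. implies $\rho_E(g)\le\rho_E(f)$; (P3) $0\le f_n\nearrow f$ a.e. implies $\rho_E(f_n)\nearrow\rho_E(f)$; (P4)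 $\rho_E(\chi_\omega)<\infty$ for all measurable $\omega\subset(0,L)$ of finite measure; and $\|f\|_E=\rho_E(f^* )$ for all $f\in E$, where $E=\{f\in\mathfrak M(0,L):\rho_E(f^* )<\infty\}$. Interpolation functor: for a compatible couple $(X_0,X_1)$ of quasi-normed spaces (both continuously embedded in a common Hausdorff topological vector space), Peetre's $K$-functional is $K(t,x;X_0,X_1)=\inf\{\|x_0\|_{X_0}+t\|x_1\|_{X_1}:x=x_0+x_1,\ x_i\in X_i\}$, $t>0$, $x\in X_0+X_1$. For $0<\Theta,r<\infty$, the space $(X_0,X_1)_{\Theta,r;E}$ consists of all $x\in X_0+X_1$ with $\|x\|_{(X_0,X_1)_{\Theta,r;E}}:=\rho_E\big(t^{-1/r}K(t^{1/\Theta},x;X_0,X_1)\big)<\infty$, where the argument of $\rho_E$ is regarded as a function of $t\in(0,L)$. *)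

theory Defs
  imports "HOL-Probability.Essential_Supremum" "HOL-Library.Function_Algebras"
begin

text \<open>
  A quasi-normed space is a carrier together with a real-valued quasi-norm. Spaces of functions
  on \<open>(0,L)\<close> are represented by sets of functions on the whole real line whose values outside
  \<open>(0,L)\<close> are irrelevant. Instead of passing to classes of a.e. equal functions, every
  function space below has a carrier that is closed under a.e. equality on \<open>(0,L)\<close>, and its
  quasi-norm vanishes exactly on the functions that are a.e. zero there. Since every measurable
  a.e. finite function is a.e. equal to an everywhere finite one, \<open>borel_measurable (leb L)\<close> at
  type \<open>complex\<close> represents the space of all measurable a.e. finite functions.
\<close>

record 'a qn_space =
  qcarrier :: "'a set"
  qnorm :: "'a \<Rightarrow> real"

definition same_qn_space :: "'a qn_space \<Rightarrow> 'a qn_space \<Rightarrow> bool" where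
  "same_qn_space X Y \<longleftrightarrow>
     qcarrier X = qcarrier Y \<and>
     (\<exists>c C. 0 < c \<and> 0 < C \<and>
        (\<forall>x\<in>qcarrier X. c * qnorm X x \<le> qnorm Y x \<and> qnorm Y x \<le> C * qnorm X x))"

definition leb :: "ereal \<Rightarrow> real measure" where
  "leb L = lebesgue_on {x. 0 < x \<and> ereal x < L}"

definition rearrangement :: "ereal \<Rightarrow> (real \<Rightarrow> complex) \<Rightarrow> real \<Rightarrow> ennreal" where
  "rearrangement L f t =
     Inf (ennreal ` {l. 0 < l \<and> emeasure (leb L) {x \<in> space (leb L). cmod (f x) > l} \<le> ennreal t})"

definition Lp :: "ereal \<Rightarrow> ereal \<Rightarrow> (real \<Rightarrow> complex) qn_space" where
  "Lp L p =
     (if p = \<infinity> then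
        \<lparr>qcarrier = {f \<in> borel_measurable (leb L). esssup (leb L) (\<lambda>x. ereal (cmod (f x))) < \<infinity>},
         qnorm = (\<lambda>f. real_of_ereal (esssup (leb L) (\<lambda>x. ereal (cmod (f x)))))\<rparr>
      else
        \<lparr>qcarrier = {f \<in> borel_measurable (leb L).
                       integrable (leb L) (\<lambda>x. cmod (f x) powr real_of_ereal p)},
         qnorm = (\<lambda>f. (\<integral>x. cmod (f x) powr real_of_ereal p \<partial>leb L) powr (1 / real_of_ereal p))\<rparr>)"

definition quasi_norm_on ::
    "ereal \<Rightarrow> (real \<Rightarrow> complex) set \<Rightarrow> ((real \<Rightarrow> complex) \<Rightarrow> ennreal) \<Rightarrow> bool" where
  "quasi_norm_on L V \<nu> \<longleftrightarrow>
     (\<forall>f\<in>V. \<nu> f = 0 \<longleftrightarrow> (AE x in leb L. f x = 0)) \<and>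
     (\<forall>c. \<forall>f\<in>V. \<nu> (\<lambda>x. c * f x) = ennreal (cmod c) * \<nu> f) \<and>
     (\<exists>C\<ge>1. \<forall>f\<in>V. \<forall>g\<in>V. \<nu> (f + g) \<le> ennreal C * (\<nu> f + \<nu> g))"

definition quasi_Banach :: "ereal \<Rightarrow> (real \<Rightarrow> complex) qn_space \<Rightarrow> bool" where
  "quasi_Banach L X \<longleftrightarrow>
     0 \<in> qcarrier X \<and>
     (\<forall>f\<in>qcarrier X. \<forall>g\<in>qcarrier X. f + g \<in> qcarrier X) \<and>
     (\<forall>c. \<forall>f\<in>qcarrier X. (\<lambda>x. c * f x) \<in> qcarrier X) \<and>
     (\<forall>f\<in>qcarrier X. 0 \<le> qnorm X f) \<and>
     quasi_norm_on L (qcarrier X) (\<lambda>f. ennreal (qnorm X f)) \<and>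
     (\<forall>F::nat \<Rightarrow> real \<Rightarrow> complex.
        (\<forall>n. F n \<in> qcarrier X) \<and>
        (\<forall>e>0. \<exists>N. \<forall>m\<ge>N. \<forall>n\<ge>N. qnorm X (F m - F n) < e) \<longrightarrow>
        (\<exists>f\<in>qcarrier X. (\<lambda>n. qnorm X (F n - f)) \<longlonglongrightarrow> 0))"

definition rho_axioms :: "ereal \<Rightarrow> ((real \<Rightarrow> complex) \<Rightarrow> ennreal) \<Rightarrow> bool" where
  "rho_axioms L \<rho> \<longleftrightarrow>
     quasi_norm_on L (borel_measurable (leb L)) \<rho> \<and>
     (\<forall>f\<in>borel_measurable (leb L). \<forall>g\<in>borel_measurable (leb L).
        (AE x in leb L. cmod (g x) \<le> cmod (f x)) \<longrightarrow> \<rho> g \<le> \<rho> f) \<and>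
     (\<forall>(u::nat \<Rightarrow> real \<Rightarrow> real) (v::real \<Rightarrow> real).
        (\<forall>n. u n \<in> borel_measurable (leb L)) \<and> v \<in> borel_measurable (leb L) \<and>
        (AE x in leb L. (\<forall>n. 0 \<le> u n x) \<and> incseq (\<lambda>n. u n x) \<and> (\<lambda>n. u n x) \<longlonglongrightarrow> v x) \<longrightarrow>
        incseq (\<lambda>n. \<rho> (\<lambda>x. complex_of_real (u n x))) \<and>
        (\<lambda>n. \<rho> (\<lambda>x. complex_of_real (u n x))) \<longlonglongrightarrow> \<rho> (\<lambda>x. complex_of_real (v x))) \<and>
     (\<forall>\<omega>\<in>sets (leb L). emeasure (leb L) \<omega> < \<infinity> \<longrightarrow> \<rho> (indicator \<omega>) < \<infinity>)"

text \<open>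
  For \<open>L = \<infinity>\<close> the rearrangement may take the value \<open>\<infinity>\<close>; the functional \<open>\<rho>\<close> is only given on
  a.e. finite functions, and is understood to be \<open>\<infinity>\<close> on the remaining ones.
\<close>

definition rho_ext :: "ereal \<Rightarrow> ((real \<Rightarrow> complex) \<Rightarrow> ennreal) \<Rightarrow> (real \<Rightarrow> ennreal) \<Rightarrow> ennreal" where
  "rho_ext L \<rho> g =
     (if AE t in leb L. g t < \<infinity> then \<rho> (\<lambda>t. complex_of_real (enn2real (g t))) else \<infinity>)"

definition ri_quasi_Banach_space ::
    "ereal \<Rightarrow> ((real \<Rightarrow> complex) \<Rightarrow> ennreal) \<Rightarrow> (real \<Rightarrow> complex) qn_space \<Rightarrow> bool" where
  "ri_quasi_Banach_space L \<rho> E \<longleftrightarrow>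
     quasi_Banach L E \<and>
     rho_axioms L \<rho> \<and>
     qcarrier E = {f \<in> borel_measurable (leb L). rho_ext L \<rho> (rearrangement L f) < \<infinity>} \<and>
     (\<forall>f\<in>qcarrier E. qnorm E f = enn2real (rho_ext L \<rho> (rearrangement L f)))"

definition sum_space :: "'a::ab_group_add qn_space \<Rightarrow> 'a qn_space \<Rightarrow> 'a set" where
  "sum_space X0 X1 = {x0 + x1 | x0 x1. x0 \<in> qcarrier X0 \<and> x1 \<in> qcarrier X1}"

definition K_functional ::
    "real \<Rightarrow> 'a::ab_group_add \<Rightarrow> 'a qn_space \<Rightarrow> 'a qn_space \<Rightarrow> real" where
  "K_functional t x X0 X1 =
     Inf {qnorm X0 x0 + t * qnorm X1 x1 | x0 x1.
            x = x0 + x1 \<and> x0 \<in> qcarrier X0 \<and> x1 \<in> qcarrier X1}"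

definition interp_norm ::
    "((real \<Rightarrow> complex) \<Rightarrow> ennreal) \<Rightarrow> real \<Rightarrow> real \<Rightarrow>
     'a::ab_group_add qn_space \<Rightarrow> 'a qn_space \<Rightarrow> 'a \<Rightarrow> ennreal" where
  "interp_norm \<rho> \<Theta> r X0 X1 x =
     \<rho> (\<lambda>t. complex_of_real (t powr (- 1 / r) * K_functional (t powr (1 / \<Theta>)) x X0 X1))"

definition interp_space ::
    "((real \<Rightarrow> complex) \<Rightarrow> ennreal) \<Rightarrow> real \<Rightarrow> real \<Rightarrow>
     'a::ab_group_add qn_space \<Rightarrow> 'a qn_space \<Rightarrow> 'a qn_space" where
  "interp_space \<rho> \<Theta> r X0 X1 =
     \<lparr>qcarrier = {x \<in> sum_space X0 X1. interp_norm \<rho> \<Theta> r X0 X1 x < \<infinity>},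
      qnorm = (\<lambda>x. enn2real (interp_norm \<rho> \<Theta> r X0 X1 x))\<rparr>"

end

theory Submission
  imports Defs
begin

text \<open>
  One exponent \<open>p\<close> serves both assertions, with \<open>p\<^sub>1 = \<infinity>\<close> and \<open>\<Theta> = p\<close>. Put
  \<open>G(t) = t\<^bsup>-1/p\<^esup> K(t\<^bsup>1/p\<^esup>, f; L\<^sub>p, L\<^sub>\<infinity>)\<close>. Chebyshev's inequality gives \<open>f\<^sup>* \<le> G\<close>.
  Conversely, cutting \<open>f\<close> at height \<open>f\<^sup>*(t)\<close> and decomposing \<open>{|f| > f\<^sup>*(t)}\<close> along the heights
  \<open>f\<^sup>*((2/3)\<^sup>k t)\<close> gives \<open>G(t) \<le> c \<Sum>\<^sub>k q\<^sup>k f\<^sup>*((2/3)\<^sup>k t)\<close> with \<open>q\<^sup>p = 5/6\<close>, where \<open>q\<close> is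
  small when \<open>p\<close> is. The dilation \<open>f\<^sup>*(t) \<mapsto> f\<^sup>*(2t/3)\<close> is bounded on \<open>E\<close>, because \<open>f\<^sup>*(2t/3)\<close>
  splits into two functions whose distribution functions are at most that of \<open>f\<close>. Hence for small \<open>q\<close>
  the series converges geometrically, in spite of the constants in the quasi-triangle inequalities,
  and the Fatou property bounds its norm.
\<close>

subsection \<open>Distribution functions and rearrangements\<close>

lemma space_leb: "space (leb L) = {x. 0 < x \<and> ereal x < L}"
  by (simp add: leb_def)

lemma interval_borel: "{x. 0 < x \<and> ereal x < L} \<in> sets borel"
proof -
  have "{x::real. 0 < x \<and> ereal x < L} = {x\<in>space borel. 0 < x \<and> ereal x < L}" by simp
  also have "\<dots> \<in> sets borel" by measurable
  finally show ?thesis .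
qed

lemma borel_measurable_leb: "f \<in> borel_measurable borel \<Longrightarrow> f \<in> borel_measurable (leb L)"
  unfolding leb_def by (intro measurable_restrict_space1 measurable_completion) simp

lemma sets_leb: "A \<in> sets borel \<Longrightarrow> A \<subseteq> space (leb L) \<Longrightarrow> A \<in> sets (leb L)"
  using interval_borel[of L] by (auto simp: leb_def sets_restrict_space_iff)

lemma emeasure_leb:
  "A \<in> sets borel \<Longrightarrow> A \<subseteq> space (leb L) \<Longrightarrow> emeasure (leb L) A = emeasure lborel A"
  using interval_borel[of L] by (simp add: leb_def emeasure_restrict_space)

lemma emeasure_leb_greaterThanLessThan:
  assumes "0 \<le> s" "ereal s \<le> L"
  shows "emeasure (leb L) {0<..<s} = ennreal s"
proof -
  have "{0<..<s} \<subseteq> space (leb L)"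
    unfolding space_leb using assms by (auto intro: less_le_trans[of "ereal _" "ereal s"])
  then show ?thesis using assms by (simp add: emeasure_leb)
qed

definition distribution :: "ereal \<Rightarrow> (real \<Rightarrow> complex) \<Rightarrow> real \<Rightarrow> ennreal" where
  "distribution L f l = emeasure (leb L) {x \<in> space (leb L). cmod (f x) > l}"

text \<open>The distribution function is right-continuous, because {|f| > l} is the increasing union
  of the sets {|f| > l + 1/(n+1)}; so its bound by \<open>t\<close> survives passing to the infimum.
  The equivalence lets later arguments compare superlevel sets instead of rearrangements.\<close>

lemma rearrangement_le_iff:
  assumes [measurable]: "f \<in> borel_measurable (leb L)" and "0 \<le> l"
  shows "rearrangement L f t \<le> ennreal l \<longleftrightarrow> distribution L f l \<le> ennreal t"
proof
  define S where "S = {l. 0 < l \<and> distribution L f l \<le> ennreal t}"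
  have R: "rearrangement L f t = Inf (ennreal ` S)"
    by (simp add: rearrangement_def S_def distribution_def)
  have anti: "distribution L f b \<le> distribution L f a" if "a \<le> b" for a b
    unfolding distribution_def using that by (intro emeasure_mono) auto
  {
    assume "rearrangement L f t \<le> ennreal l"
    have small: "distribution L f (l + 1 / Suc n) \<le> ennreal t" for n
    proof -
      have "Inf (ennreal ` S) < ennreal (l + 1 / Suc n)"
        using \<open>rearrangement L f t \<le> ennreal l\<close> \<open>0 \<le> l\<close> unfolding R
        by (intro le_less_trans[of "Inf (ennreal ` S)" "ennreal l"]) (simp_all add: ennreal_less_iff)
      then obtain m where "m \<in> S" "ennreal m < ennreal (l + 1 / Suc n)"
        unfolding Inf_less_iff by blast
      then have "distribution L f m \<le> ennreal t" "m < l + 1 / Suc n"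
        using ennreal_less_iff[of m] by (auto simp: S_def)
      then show ?thesis using anti[of m "l + 1 / Suc n"] by simp
    qed
    have "{x \<in> space (leb L). cmod (f x) > l} =
        (\<Union>n. {x \<in> space (leb L). cmod (f x) > l + 1 / Suc n})"
    proof (intro equalityI subsetI)
      fix x assume x: "x \<in> {x \<in> space (leb L). cmod (f x) > l}"
      then obtain n where "1 / Suc n < cmod (f x) - l"
        using reals_Archimedean[of "cmod (f x) - l"] by (auto simp: inverse_eq_divide)
      then show "x \<in> (\<Union>n. {x \<in> space (leb L). cmod (f x) > l + 1 / Suc n})"
        using x by (auto intro!: exI[of _ n])
    next
      fix x assume "x \<in> (\<Union>n. {x \<in> space (leb L). cmod (f x) > l + 1 / Suc n})"
      then obtain n where "x \<in> space (leb L)" "cmod (f x) > l + 1 / Suc n" by auto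
      moreover have "1 / Suc n > (0::real)" by simp
      ultimately have "x \<in> space (leb L)" "cmod (f x) > l" by linarith+
      then show "x \<in> {x \<in> space (leb L). cmod (f x) > l}" by simp
    qed
    then have "distribution L f l =
        emeasure (leb L) (\<Union>n. {x \<in> space (leb L). cmod (f x) > l + 1 / Suc n})"
      by (simp add: distribution_def)
    also have "\<dots> = (SUP n. distribution L f (l + 1 / Suc n))"
      unfolding distribution_def
    proof (intro SUP_emeasure_incseq[symmetric])
      show "incseq (\<lambda>n. {x \<in> space (leb L). cmod (f x) > l + 1 / Suc n})"
      proof (intro incseq_SucI subsetI)
        fix n x assume "x \<in> {x \<in> space (leb L). cmod (f x) > l + 1 / Suc n}"
        moreover have "1 / real (Suc (Suc n)) \<le> 1 / Suc n" by (simp add: frac_le)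
        ultimately show "x \<in> {x \<in> space (leb L). cmod (f x) > l + 1 / Suc (Suc n)}" by auto
      qed
    qed auto
    also have "\<dots> \<le> ennreal t" using small by (intro SUP_least) auto
    finally show "distribution L f l \<le> ennreal t" .
  next
    assume d: "distribution L f l \<le> ennreal t"
    \<comment> \<open>\<open>S\<close> contains only positive heights, so \<open>l\<close> itself is
      not admissible when it is 0; \<open>l + e\<close> always is.\<close>
    show "rearrangement L f t \<le> ennreal l"
    proof (rule ennreal_le_epsilon)
      fix e :: real assume "0 < e"
      then have "l + e \<in> S" using d anti[of l "l + e"] \<open>0 \<le> l\<close> by (auto simp: S_def)
      then have "rearrangement L f t \<le> ennreal (l + e)" unfolding R by (intro Inf_lower) auto
      then show "rearrangement L f t \<le> ennreal l + ennreal e"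
        using \<open>0 < e\<close> \<open>0 \<le> l\<close> by (simp add: ennreal_plus)
    qed
  }
qed

lemma rearrangement_mono_measure:
  assumes "\<And>l. 0 \<le> l \<Longrightarrow> distribution L f l \<le> distribution L g l"
  shows "rearrangement L f t \<le> rearrangement L g t"
  unfolding rearrangement_def using assms
  by (intro Inf_superset_mono image_mono) (auto simp flip: distribution_def dest: less_imp_le intro: order_trans[rotated])

lemma antimono_rearrangement: "s \<le> t \<Longrightarrow> rearrangement L f t \<le> rearrangement L f s"
  unfolding rearrangement_def
  by (intro Inf_superset_mono image_mono subsetI) (auto elim: order_trans intro: ennreal_leI)

text \<open>By \<open>rearrangement_le_iff\<close>, the sublevel set at a finite height is the set
  where \<open>ennreal t\<close> exceeds or equals a constant. Measurability is stated on the whole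
  line so that dilates are covered as well.\<close>

lemma rearrangement_measurable[measurable]:
  assumes [measurable]: "f \<in> borel_measurable (leb L)"
  shows "rearrangement L f \<in> borel_measurable borel"
proof (rule borel_measurableI_le)
  fix y :: ennreal
  show "{x \<in> space borel. rearrangement L f x \<le> y} \<in> sets borel"
  proof (cases y)
    case (real r)
    then show ?thesis by (simp add: rearrangement_le_iff)
  qed simp
qed

lemma rearrangement_le_iff_enn2real:
  assumes [measurable]: "f \<in> borel_measurable (leb L)" and "0 \<le> l" "rearrangement L f t < \<infinity>"
  shows "enn2real (rearrangement L f t) \<le> l \<longleftrightarrow> distribution L f l \<le> ennreal t"
  using assms(3) \<open>0 \<le> l\<close> unfolding rearrangement_le_iff[OF assms(1,2), symmetric]
  by (cases "rearrangement L f t") auto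

text \<open>The interval has measure \<open>s > 0\<close>, so it is not contained in an exceptional
  null set.\<close>

lemma AE_leb_interval:
  assumes "AE x in leb L. P x" "0 < s" "ereal s \<le> L"
  obtains x where "x \<in> {0<..<s}" "P x"
proof -
  have False if "\<And>x. x \<in> {0<..<s} \<Longrightarrow> \<not> P x"
  proof -
    have "AE x in leb L. x \<notin> {0<..<s}" using assms(1) that by (auto elim!: eventually_mono)
    moreover have "{0<..<s} \<subseteq> space (leb L)"
      unfolding space_leb using assms(3) by (auto intro: less_le_trans[of "ereal _" "ereal s"])
    ultimately have "emeasure (leb L) {0<..<s} = 0"
      by (subst (asm) AE_iff_measurable[of "{0<..<s}"]) (auto intro: sets_leb)
    then show False using emeasure_leb_greaterThanLessThan[of s L] assms by simp
  qed
  then show thesis using that by blast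
qed

lemma pos_ereal_real:
  assumes "0 < (L::ereal)" "0 < t"
  obtains s where "0 < s" "s \<le> t" "ereal s \<le> L"
proof (cases L)
  case (real r)
  then show ?thesis using assms that[of "min t r"] by auto
qed (use assms that[of t] in auto)

text \<open>By monotonicity an infinite value at \<open>t\<close> would persist to the left of
  \<open>t\<close>, hence on a set of positive measure in (0,L).\<close>

lemma rearrangement_finite:
  assumes "0 < L" "AE t in leb L. rearrangement L f t < \<infinity>" "0 < t"
  shows "rearrangement L f t < \<infinity>"
proof (rule ccontr)
  assume infinite: "\<not> rearrangement L f t < \<infinity>"
  obtain s where s: "0 < s" "s \<le> t" "ereal s \<le> L"
    using pos_ereal_real[OF assms(1,3)] .
  obtain x where "x \<in> {0<..<s}" "rearrangement L f x < \<infinity>"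
    using AE_leb_interval[OF assms(2) s(1,3)] .
  then show False
    using infinite antimono_rearrangement[of x t L f] s by auto
qed

subsection \<open>The K-functional of the couple of Lebesgue spaces\<close>

text \<open>Since (0,L) is not null, some point satisfies the a.e. bound |f(x)| \<le>
  \<open>e\<close>. This excludes a negative essential supremum, so \<open>e\<close> is a
  nonnegative real and \<open>real_of_ereal\<close> loses nothing.\<close>

lemma Lp_top_norm:
  assumes "0 < L" "f \<in> qcarrier (Lp L \<infinity>)"
  shows "0 \<le> qnorm (Lp L \<infinity>) f" "AE x in leb L. cmod (f x) \<le> qnorm (Lp L \<infinity>) f"
proof -
  define e where "e = esssup (leb L) (\<lambda>x. ereal (cmod (f x)))"
  have "e < \<infinity>" and norm: "qnorm (Lp L \<infinity>) f = real_of_ereal e"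
    using assms(2) by (auto simp: Lp_def e_def)
  have AE: "AE x in leb L. ereal (cmod (f x)) \<le> e" unfolding e_def by (rule esssup_AE)
  obtain s where "0 < s" "ereal s \<le> L" using pos_ereal_real[OF assms(1) zero_less_one] by blast
  then obtain x where "ereal (cmod (f x)) \<le> e" using AE_leb_interval[OF AE] by blast
  then have "0 \<le> e" by (auto intro: order_trans[of 0 "ereal (cmod (f x))"])
  then obtain r where "e = ereal r" "0 \<le> r" using \<open>e < \<infinity>\<close> by (cases e) auto
  then show "0 \<le> qnorm (Lp L \<infinity>) f" "AE x in leb L. cmod (f x) \<le> qnorm (Lp L \<infinity>) f"
    using AE by (simp_all add: norm)
qed

lemma Lp_topI:
  assumes "0 < L" "f \<in> borel_measurable (leb L)" "\<And>x. cmod (f x) \<le> c"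
  shows "f \<in> qcarrier (Lp L \<infinity>)" "qnorm (Lp L \<infinity>) f \<le> c"
proof -
  have le: "esssup (leb L) (\<lambda>x. ereal (cmod (f x))) \<le> ereal c"
    using assms(2,3) by (intro esssup_I) auto
  then show f: "f \<in> qcarrier (Lp L \<infinity>)" using assms(2) by (auto simp: Lp_def)
  \<comment> \<open>Covers the case of essential supremum -\<infinity>, which
    \<open>real_of_ereal\<close> sends to 0.\<close>
  have "0 \<le> c" using assms(3)[of 0] norm_ge_zero order_trans by blast
  then show "qnorm (Lp L \<infinity>) f \<le> c"
    using le by (cases "esssup (leb L) (\<lambda>x. ereal (cmod (f x)))") (auto simp: Lp_def)
qed

lemma Lp_norm_nonneg: "0 \<le> qnorm (Lp L (ereal p)) f"
  by (simp add: Lp_def)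

lemma LpI:
  assumes "f \<in> borel_measurable (leb L)" "0 < p" "0 \<le> c"
    and "(\<integral>\<^sup>+x. ennreal (cmod (f x) powr p) \<partial>leb L) \<le> ennreal c"
  shows "f \<in> qcarrier (Lp L (ereal p))" "qnorm (Lp L (ereal p)) f \<le> c powr (1 / p)"
proof -
  have int: "integrable (leb L) (\<lambda>x. cmod (f x) powr p)"
    using assms(1,4) by (intro integrableI_bounded) (auto intro: le_less_trans)
  then show "f \<in> qcarrier (Lp L (ereal p))" using assms(1) by (simp add: Lp_def)
  have "(\<integral>x. cmod (f x) powr p \<partial>leb L) \<le> c"
    using assms(3,4) int by (simp add: nn_integral_eq_integral)
  then show "qnorm (Lp L (ereal p)) f \<le> c powr (1 / p)"
    using \<open>0 < p\<close> by (simp add: Lp_def powr_mono2)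
qed

lemma Lp_weak_type:
  assumes "0 < p" "0 < t" "f \<in> qcarrier (Lp L (ereal p))"
  shows "distribution L f (t powr (- 1 / p) * qnorm (Lp L (ereal p)) f) \<le> ennreal t"
proof -
  define I where "I = (\<integral>x. cmod (f x) powr p \<partial>leb L)"
  have [measurable]: "f \<in> borel_measurable (leb L)"
    and int: "integrable (leb L) (\<lambda>x. cmod (f x) powr p)"
    and norm: "qnorm (Lp L (ereal p)) f = I powr (1 / p)"
    using assms by (auto simp: Lp_def I_def)
  have "0 \<le> I" unfolding I_def by simp
  show ?thesis
  proof (cases "I = 0")
    case True
    then have "AE x in leb L. cmod (f x) powr p = 0"
      using integral_nonneg_eq_0_iff_AE[OF int] by (simp add: I_def)
    then have "AE x in leb L. \<not> cmod (f x) > 0" by (auto elim!: eventually_mono)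
    then have "emeasure (leb L) {x \<in> space (leb L). cmod (f x) > 0} = 0"
      by (subst (asm) AE_iff_measurable[OF _ refl]) auto
    then show ?thesis using True \<open>0 < p\<close> by (simp add: norm distribution_def)
  next
    case False
    with \<open>0 \<le> I\<close> have "0 < I" by simp
    define l where "l = t powr (- 1 / p) * I powr (1 / p)"
    have "0 < l" using \<open>0 < I\<close> \<open>0 < t\<close> by (simp add: l_def)
    have l: "l powr p = I / t"
      using \<open>0 < I\<close> \<open>0 < t\<close> \<open>0 < p\<close> by (simp add: l_def powr_mult powr_divide powr_powr powr_minus_divide)
    have "distribution L f l \<le> emeasure (leb L) {x \<in> space (leb L). cmod (f x) powr p \<ge> I / t}"
      unfolding distribution_def l[symmetric] using \<open>0 < l\<close> \<open>0 < p\<close>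
      by (intro emeasure_mono) (auto intro!: powr_mono2)
    also have "\<dots> \<le> ennreal ((1 / (I / t)) * I)"
      unfolding I_def using \<open>0 < I\<close> \<open>0 < t\<close>
      by (intro integral_Markov_inequality int) (auto simp flip: I_def)
    also have "\<dots> = ennreal t" using \<open>0 < I\<close> by simp
    finally show ?thesis by (simp add: l_def norm)
  qed
qed

text \<open>Almost everywhere |g| \<le> \<open>?b\<close>, so up to a null set |f + g| >
  \<open>?a + ?b\<close> forces |f| > \<open>?a\<close>; the weak-type bound finishes the
  estimate.\<close>

lemma rearrangement_add_le:
  assumes "0 < L" "0 < p" "0 < t"
    and f: "f \<in> qcarrier (Lp L (ereal p))" and g: "g \<in> qcarrier (Lp L \<infinity>)"
  shows "rearrangement L (f + g) t \<le>
    ennreal (t powr (- 1 / p) * qnorm (Lp L (ereal p)) f + qnorm (Lp L \<infinity>) g)"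
proof -
  let ?a = "t powr (- 1 / p) * qnorm (Lp L (ereal p)) f"
  let ?b = "qnorm (Lp L \<infinity>) g"
  have [measurable]: "f \<in> borel_measurable (leb L)" "g \<in> borel_measurable (leb L)"
    using f g by (auto simp: Lp_def)
  then have [measurable]: "f + g \<in> borel_measurable (leb L)" by (simp add: plus_fun_def)
  have "distribution L (f + g) (?a + ?b) \<le> distribution L f ?a"
    unfolding distribution_def
  proof (rule emeasure_mono_AE)
    show "AE x in leb L. x \<in> {x \<in> space (leb L). cmod ((f + g) x) > ?a + ?b} \<longrightarrow>
        x \<in> {x \<in> space (leb L). cmod (f x) > ?a}"
      using Lp_top_norm(2)[OF assms(1) g]
    proof eventually_elim
      case (elim x)
      then show ?case using norm_triangle_ineq[of "f x" "g x"] by auto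
    qed
  qed measurable
  also have "\<dots> \<le> ennreal t" by (rule Lp_weak_type[OF assms(2,3) f])
  finally show ?thesis
    using Lp_top_norm(1)[OF assms(1) g] Lp_norm_nonneg[of L p f]
    by (subst rearrangement_le_iff) auto
qed

text \<open>The infimum is a real one, so it is informative only for a nonempty set that is bounded
  below. Nonnegativity gives the bound; in \<open>K_functional_greatest\<close>, membership in
  \<open>sum_space\<close> gives nonemptiness.\<close>

lemma K_functional_bdd_below:
  assumes "\<And>y. y \<in> qcarrier X \<Longrightarrow> 0 \<le> qnorm X y" "\<And>y. y \<in> qcarrier Y \<Longrightarrow> 0 \<le> qnorm Y y" "0 \<le> s"
  shows "bdd_below {qnorm X x0 + s * qnorm Y x1 | x0 x1.
            x = x0 + x1 \<and> x0 \<in> qcarrier X \<and> x1 \<in> qcarrier Y}"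
  using assms by (intro bdd_belowI[of _ 0]) auto

lemma K_functional_le:
  assumes "\<And>y. y \<in> qcarrier X \<Longrightarrow> 0 \<le> qnorm X y" "\<And>y. y \<in> qcarrier Y \<Longrightarrow> 0 \<le> qnorm Y y"
    and "0 \<le> s" "x0 \<in> qcarrier X" "x1 \<in> qcarrier Y"
  shows "K_functional s (x0 + x1) X Y \<le> qnorm X x0 + s * qnorm Y x1"
  unfolding K_functional_def
  by (rule cInf_lower[OF _ K_functional_bdd_below]) (use assms in auto)

lemma K_functional_greatest:
  assumes "x \<in> sum_space X Y"
    and "\<And>x0 x1. x = x0 + x1 \<Longrightarrow> x0 \<in> qcarrier X \<Longrightarrow> x1 \<in> qcarrier Y \<Longrightarrow>
      c \<le> qnorm X x0 + s * qnorm Y x1"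
  shows "c \<le> K_functional s x X Y"
  unfolding K_functional_def using assms by (intro cInf_greatest) (auto simp: sum_space_def)

lemma K_functional_mono:
  assumes "\<And>y. y \<in> qcarrier X \<Longrightarrow> 0 \<le> qnorm X y" "\<And>y. y \<in> qcarrier Y \<Longrightarrow> 0 \<le> qnorm Y y"
    and "x \<in> sum_space X Y" "0 \<le> s" "s \<le> s'"
  shows "K_functional s x X Y \<le> K_functional s' x X Y"
proof (rule K_functional_greatest[OF assms(3)])
  fix x0 x1 assume x: "x = x0 + x1" "x0 \<in> qcarrier X" "x1 \<in> qcarrier Y"
  have "K_functional s x X Y \<le> qnorm X x0 + s * qnorm Y x1"
    unfolding x(1) by (intro K_functional_le assms x)
  also have "\<dots> \<le> qnorm X x0 + s' * qnorm Y x1"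
    using assms x by (intro add_left_mono mult_right_mono) auto
  finally show "K_functional s x X Y \<le> qnorm X x0 + s' * qnorm Y x1" .
qed

lemma K_functional_measurable:
  assumes "\<And>y. y \<in> qcarrier X \<Longrightarrow> 0 \<le> qnorm X y" "\<And>y. y \<in> qcarrier Y \<Longrightarrow> 0 \<le> qnorm Y y"
    and "x \<in> sum_space X Y" "0 \<le> a"
  shows "(\<lambda>t. t powr b * K_functional (t powr a) x X Y) \<in> borel_measurable (leb L)"
proof -
  \<comment> \<open>Replacing \<open>t\<close> by \<open>max 0 t\<close> makes the function monotone
    on the whole line and changes nothing on (0,L).\<close>
  have "mono (\<lambda>t. K_functional (max 0 t powr a) x X Y)"
    using \<open>0 \<le> a\<close> by (intro monoI K_functional_mono assms powr_mono2) auto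
  then have [measurable]: "(\<lambda>t. K_functional (max 0 t powr a) x X Y) \<in> borel_measurable borel"
    by (rule borel_measurable_mono)
  have "(\<lambda>t. t powr b * K_functional (max 0 t powr a) x X Y) \<in> borel_measurable (leb L)"
    by (intro borel_measurable_leb) measurable
  then show ?thesis
    by (rule measurable_cong[THEN iffD1, rotated]) (simp add: space_leb)
qed

text \<open>\<open>rearrangement_add_le\<close> bounds the left side for every decomposition of
  \<open>x\<close>, with the factor t^(1/p) of the K-functional cancelled by the prefactor; then the
  infimum over decompositions is taken.\<close>

lemma rearrangement_le_K_functional:
  assumes "0 < L" "0 < p" "0 < t" and x: "x \<in> sum_space (Lp L (ereal p)) (Lp L \<infinity>)"
  shows "rearrangement L x t \<le>
    ennreal (t powr (- 1 / p) * K_functional (t powr (1 / p)) x (Lp L (ereal p)) (Lp L \<infinity>))"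
proof -
  have le: "rearrangement L x t \<le> ennreal (t powr (- 1 / p) *
      (qnorm (Lp L (ereal p)) x0 + t powr (1 / p) * qnorm (Lp L \<infinity>) x1))"
    if "x = x0 + x1" "x0 \<in> qcarrier (Lp L (ereal p))" "x1 \<in> qcarrier (Lp L \<infinity>)" for x0 x1
    using rearrangement_add_le[OF assms(1-3) that(2,3)] \<open>0 < t\<close>
    by (simp add: that(1) algebra_simps flip: powr_add)
  \<comment> \<open>A single decomposition already shows that the rearrangement is finite at
    \<open>t\<close>, so the infimum can be handled in the reals.\<close>
  obtain x0 x1 where "x = x0 + x1" "x0 \<in> qcarrier (Lp L (ereal p))" "x1 \<in> qcarrier (Lp L \<infinity>)"
    using x by (auto simp: sum_space_def)
  from le[OF this] obtain r where r: "rearrangement L x t = ennreal r" "0 \<le> r"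
    by (cases "rearrangement L x t") (auto simp: top_unique)
  have "t powr (1 / p) * r \<le> K_functional (t powr (1 / p)) x (Lp L (ereal p)) (Lp L \<infinity>)"
  proof (rule K_functional_greatest[OF x])
    fix x0 x1 assume x': "x = x0 + x1" "x0 \<in> qcarrier (Lp L (ereal p))" "x1 \<in> qcarrier (Lp L \<infinity>)"
    let ?N = "qnorm (Lp L (ereal p)) x0 + t powr (1 / p) * qnorm (Lp L \<infinity>) x1"
    have "0 \<le> ?N" using Lp_norm_nonneg Lp_top_norm(1)[OF assms(1) x'(3)] by simp
    then have "r \<le> t powr (- 1 / p) * ?N"
      using le[OF x'] by (simp add: r)
    then have "t powr (1 / p) * r \<le> t powr (1 / p) * (t powr (- 1 / p) * ?N)"
      by (intro mult_left_mono) auto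
    also have "\<dots> = ?N" using \<open>0 < t\<close> by (simp flip: mult.assoc powr_add)
    finally show "t powr (1 / p) * r \<le> ?N" .
  qed
  then have "t powr (- 1 / p) * (t powr (1 / p) * r) \<le>
      t powr (- 1 / p) * K_functional (t powr (1 / p)) x (Lp L (ereal p)) (Lp L \<infinity>)"
    by (intro mult_left_mono) auto
  also have "t powr (- 1 / p) * (t powr (1 / p) * r) = r"
    using \<open>0 < t\<close> by (simp flip: mult.assoc powr_add)
  finally show ?thesis by (simp add: r ennreal_leI)
qed

subsection \<open>Dilations in rearrangement-invariant spaces\<close>

text \<open>The union of the intervals [2^n, 2^(n+1)) over all integers n of one parity, even n for
  \<open>b = True\<close>.\<close>

definition dyadic_part :: "bool \<Rightarrow> real set" where
  "dyadic_part b = {x. 0 < x \<and> (even \<lfloor>log 2 x\<rfloor> \<longleftrightarrow> b)}"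

lemma dyadic_part_borel[measurable]: "dyadic_part b \<in> sets borel"
proof -
  have "dyadic_part b = {x\<in>space borel. 0 < x \<and> (even \<lfloor>log 2 x\<rfloor> \<longleftrightarrow> b)}"
    by (simp add: dyadic_part_def)
  also have "\<dots> \<in> sets borel" by measurable
  finally show ?thesis .
qed

text \<open>
  Doubling exchanges the two parts, so \<open>|A \<inter> (0,t)| \<le> |A \<inter> (0,2t)| = 2 |B \<inter> (0,t)|\<close>
  for \<open>{A, B}\<close> the two parts, while \<open>|A \<inter> (0,t)| + |B \<inter> (0,t)| = t\<close>.
\<close>

lemma emeasure_dyadic_part:
  assumes "0 \<le> t"
  shows "emeasure lborel (dyadic_part b \<inter> {0<..<t}) \<le> ennreal (2 * t / 3)"
proof -
  have fin: "S \<inter> {0<..<s} \<in> lmeasurable" if "S \<in> sets borel" for S and s :: real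
    using that by (intro bounded_set_imp_lmeasurable) (auto intro: bounded_subset[OF bounded_closed_interval[of 0 s]])
  define a where "a b = measure lebesgue (dyadic_part b \<inter> {0<..<t})" for b
  have "(\<lambda>x. 2 *\<^sub>R x + 0) ` (dyadic_part (\<not> b) \<inter> {0<..<t}) = dyadic_part b \<inter> {0<..<2 * t}"
  proof (intro equalityI subsetI)
    fix x assume x: "x \<in> dyadic_part b \<inter> {0<..<2 * t}"
    then have "log 2 x = log 2 (x / 2) + 1" by (simp add: dyadic_part_def log_divide)
    then have "\<lfloor>log 2 x\<rfloor> = \<lfloor>log 2 (x / 2)\<rfloor> + 1" by simp
    then have "x / 2 \<in> dyadic_part (\<not> b) \<inter> {0<..<t}" using x by (auto simp: dyadic_part_def)
    then show "x \<in> (\<lambda>x. 2 *\<^sub>R x + 0) ` (dyadic_part (\<not> b) \<inter> {0<..<t})"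
      by (intro image_eqI[of _ _ "x / 2"]) auto
  qed (auto simp: dyadic_part_def log_mult)
  then have "measure lebesgue (dyadic_part b \<inter> {0<..<2 * t}) = 2 * a (\<not> b)"
    using measure_lebesgue_affine[of 2 0 "dyadic_part (\<not> b) \<inter> {0<..<t}"] by (simp add: a_def)
  moreover have "a b \<le> measure lebesgue (dyadic_part b \<inter> {0<..<2 * t})"
    unfolding a_def using assms by (intro measure_mono_fmeasurable fin) (auto intro: fin fmeasurableD)
  moreover have "a b + a (\<not> b) = t"
  proof -
    have disjoint: "(dyadic_part b \<inter> {0<..<t}) \<inter> (dyadic_part (\<not> b) \<inter> {0<..<t}) = {}"
      by (auto simp: dyadic_part_def)
    have "measure lebesgue ((dyadic_part b \<inter> {0<..<t}) \<union> (dyadic_part (\<not> b) \<inter> {0<..<t})) =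
        a b + a (\<not> b)"
      unfolding a_def
      using disjoint by (subst measure_Un3) (auto intro: fin)
    moreover have "(dyadic_part b \<inter> {0<..<t}) \<union> (dyadic_part (\<not> b) \<inter> {0<..<t}) = {0<..<t}"
      by (auto simp: dyadic_part_def)
    ultimately show ?thesis using assms by simp
  qed
  ultimately have "a b \<le> 2 * t / 3" by simp
  moreover have "emeasure lborel (dyadic_part b \<inter> {0<..<t}) = ennreal (a b)"
    unfolding a_def using emeasure_eq_measure2[OF fin[of "dyadic_part b" t]] by simp
  ultimately show ?thesis by (simp add: ennreal_leI)
qed

section \<open>The functional \<rho>, the norm of \<open>E\<close>, and the bound for
  dilations\<close>

locale ri_space =
  fixes L :: ereal
    and \<rho> :: "(real \<Rightarrow> complex) \<Rightarrow> ennreal"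
    and E :: "(real \<Rightarrow> complex) qn_space"
  assumes L_pos: "0 < L"
    and ri: "ri_quasi_Banach_space L \<rho> E"
begin

text \<open>\<open>enn2real\<close> sends \<infinity> to 0, so this is faithful only where the
  rearrangement is finite; for members of \<open>E\<close>, \<open>carrier_finite\<close> guarantees
  that at every \<open>t > 0\<close>.\<close>

definition rr :: "(real \<Rightarrow> complex) \<Rightarrow> real \<Rightarrow> real" where
  "rr f t = enn2real (rearrangement L f t)"

lemma carrier_iff:
  "f \<in> qcarrier E \<longleftrightarrow> f \<in> borel_measurable (leb L) \<and> rho_ext L \<rho> (rearrangement L f) < \<infinity>"
  using ri by (auto simp: ri_quasi_Banach_space_def)

lemma carrier_measurable: "f \<in> qcarrier E \<Longrightarrow> f \<in> borel_measurable (leb L)"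
  by (simp add: carrier_iff)

lemma carrier_finite:
  assumes "f \<in> qcarrier E" "0 < t"
  shows "rearrangement L f t < \<infinity>"
  using assms by (intro rearrangement_finite[OF L_pos]) (auto simp: carrier_iff rho_ext_def split: if_splits)

lemma AE_leb_posI: "(\<And>t. t \<in> space (leb L) \<Longrightarrow> 0 < t \<Longrightarrow> P t) \<Longrightarrow> AE t in leb L. P t"
  by (intro AE_I2) (auto simp: space_leb)

lemma carrierI:
  assumes "f \<in> borel_measurable (leb L)" "\<And>t. t \<in> space (leb L) \<Longrightarrow> rearrangement L f t < \<infinity>"
    and "\<rho> (\<lambda>t. complex_of_real (rr f t)) < \<infinity>"
  shows "f \<in> qcarrier E"
  using assms by (auto simp: carrier_iff rho_ext_def rr_def intro!: AE_I2)

lemma ennreal_qnorm: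
  assumes "f \<in> qcarrier E"
  shows "ennreal (qnorm E f) = \<rho> (\<lambda>t. complex_of_real (rr f t))"
    and "0 \<le> qnorm E f"
proof -
  have eq: "qnorm E f = enn2real (rho_ext L \<rho> (rearrangement L f))"
    using assms ri by (auto simp: ri_quasi_Banach_space_def)
  then show "0 \<le> qnorm E f" by simp
  have "AE t in leb L. rearrangement L f t < \<infinity>"
    using carrier_finite[OF assms] by (intro AE_leb_posI)
  then have "rho_ext L \<rho> (rearrangement L f) = \<rho> (\<lambda>t. complex_of_real (rr f t))"
    by (simp add: rho_ext_def rr_def)
  moreover have "rho_ext L \<rho> (rearrangement L f) < \<infinity>" using assms by (simp add: carrier_iff)
  ultimately show "ennreal (qnorm E f) = \<rho> (\<lambda>t. complex_of_real (rr f t))"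
    by (simp add: eq less_top)
qed

text \<open>Taken from \<open>quasi_Banach\<close>. It does not follow directly from the inequality
  for \<rho>, because rearrangement is not subadditive. It is what bounds dilations, whereas
  \<open>rho_triangle\<close> handles sums of rearrangements.\<close>

lemma qnorm_triangle:
  obtains C where "1 \<le> C" and "\<And>f g. f \<in> qcarrier E \<Longrightarrow> g \<in> qcarrier E \<Longrightarrow>
      f + g \<in> qcarrier E \<and> qnorm E (f + g) \<le> C * (qnorm E f + qnorm E g)"
proof -
  have qb: "quasi_Banach L E" using ri by (simp add: ri_quasi_Banach_space_def)
  then obtain C where C: "1 \<le> C" "\<And>f g. f \<in> qcarrier E \<Longrightarrow> g \<in> qcarrier E \<Longrightarrow>
      ennreal (qnorm E (f + g)) \<le> ennreal C * (ennreal (qnorm E f) + ennreal (qnorm E g))"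
    by (auto simp: quasi_Banach_def quasi_norm_on_def)
  have "qnorm E (f + g) \<le> C * (qnorm E f + qnorm E g)"
    if "f \<in> qcarrier E" "g \<in> qcarrier E" for f g
    using C(2)[OF that] C(1) ennreal_qnorm(2)[OF that(1)] ennreal_qnorm(2)[OF that(2)]
    by (simp add: ennreal_mult'[symmetric] ennreal_plus[symmetric] ennreal_le_iff del: ennreal_plus)
  moreover have "f + g \<in> qcarrier E" if "f \<in> qcarrier E" "g \<in> qcarrier E" for f g
    using qb that by (simp add: quasi_Banach_def)
  ultimately show thesis using C(1) that by blast
qed

lemma rho_axioms: "rho_axioms L \<rho>"
  using ri by (simp add: ri_quasi_Banach_space_def)

lemma rho_mono:
  assumes "f \<in> borel_measurable (leb L)" "g \<in> borel_measurable (leb L)"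
    and "\<And>t. t \<in> space (leb L) \<Longrightarrow> \<bar>f t\<bar> \<le> \<bar>g t\<bar>"
  shows "\<rho> (\<lambda>t. complex_of_real (f t)) \<le> \<rho> (\<lambda>t. complex_of_real (g t))"
  using rho_axioms assms unfolding rho_axioms_def by (auto intro!: AE_I2)

lemma rho_cong:
  assumes "f \<in> borel_measurable (leb L)" "g \<in> borel_measurable (leb L)"
    and "\<And>t. t \<in> space (leb L) \<Longrightarrow> f t = g t"
  shows "\<rho> (\<lambda>t. complex_of_real (f t)) = \<rho> (\<lambda>t. complex_of_real (g t))"
  using assms by (intro antisym rho_mono) auto

lemma rho_scale:
  assumes "f \<in> borel_measurable (leb L)" "0 \<le> c"
  shows "\<rho> (\<lambda>t. complex_of_real (c * f t)) = ennreal c * \<rho> (\<lambda>t. complex_of_real (f t))"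
proof -
  have "\<forall>c. \<forall>f\<in>borel_measurable (leb L). \<rho> (\<lambda>x. c * f x) = ennreal (cmod c) * \<rho> f"
    using rho_axioms by (simp add: rho_axioms_def quasi_norm_on_def)
  from this[rule_format, of "\<lambda>t. complex_of_real (f t)" "complex_of_real c"] show ?thesis
    using assms by simp
qed

lemma rho_triangle:
  obtains C where "1 \<le> C" and
    "\<And>f g. f \<in> borel_measurable (leb L) \<Longrightarrow> g \<in> borel_measurable (leb L) \<Longrightarrow>
      \<rho> (\<lambda>t. complex_of_real (f t + g t)) \<le>
      ennreal C * (\<rho> (\<lambda>t. complex_of_real (f t)) + \<rho> (\<lambda>t. complex_of_real (g t)))"
proof -
  obtain C where C: "1 \<le> C" "\<forall>f\<in>borel_measurable (leb L). \<forall>g\<in>borel_measurable (leb L).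
      \<rho> (f + g) \<le> ennreal C * (\<rho> f + \<rho> g)"
    using rho_axioms by (auto simp: rho_axioms_def quasi_norm_on_def)
  show thesis
  proof (rule that[OF C(1)])
    fix f g :: "real \<Rightarrow> real"
    assume "f \<in> borel_measurable (leb L)" "g \<in> borel_measurable (leb L)"
    then show "\<rho> (\<lambda>t. complex_of_real (f t + g t)) \<le>
      ennreal C * (\<rho> (\<lambda>t. complex_of_real (f t)) + \<rho> (\<lambda>t. complex_of_real (g t)))"
      using C(2)[rule_format, of "\<lambda>t. complex_of_real (f t)" "\<lambda>t. complex_of_real (g t)"]
      by (simp add: plus_fun_def)
  qed
qed

text \<open>Serves to turn a bound on \<rho> of a decreasing function into a pointwise
  bound.\<close>

lemma rho_indicator_pos:
  assumes "0 < t" "ereal t \<le> L"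
  shows "0 < \<rho> (\<lambda>x. complex_of_real (indicator {0<..<t} x))"
proof -
  have "\<not> (AE x in leb L. complex_of_real (indicator {0<..<t} x) = 0)"
    using AE_leb_interval[OF _ assms, of "\<lambda>x. complex_of_real (indicator {0<..<t} x) = 0"] by auto
  moreover have "(\<lambda>x. complex_of_real (indicator {0<..<t} x)) \<in> borel_measurable (leb L)"
    by (intro borel_measurable_leb) measurable
  moreover have zero_iff: "\<rho> f = 0 \<longleftrightarrow> (AE x in leb L. f x = 0)"
    if "f \<in> borel_measurable (leb L)" for f
    using rho_axioms that by (simp add: rho_axioms_def quasi_norm_on_def)
  ultimately have "\<rho> (\<lambda>x. complex_of_real (indicator {0<..<t} x)) \<noteq> 0" by (simp add: zero_iff)
  then show ?thesis by (simp add: zero_less_iff_neq_zero)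
qed

lemma rr_nonneg[simp]: "0 \<le> rr f t"
  by (simp add: rr_def)

lemma rr_measurable[measurable]:
  "f \<in> borel_measurable (leb L) \<Longrightarrow> rr f \<in> borel_measurable borel"
  unfolding rr_def by measurable

lemma rr_measurable_leb[measurable]:
  "f \<in> borel_measurable (leb L) \<Longrightarrow> rr f \<in> borel_measurable (leb L)"
  by (rule borel_measurable_leb[OF rr_measurable])

lemma rr_le_iff:
  assumes "f \<in> qcarrier E" "0 < t" "0 \<le> l"
  shows "rr f t \<le> l \<longleftrightarrow> distribution L f l \<le> ennreal t"
  unfolding rr_def using assms carrier_finite
  by (intro rearrangement_le_iff_enn2real carrier_measurable) auto

lemma rr_antimono:
  assumes "f \<in> qcarrier E" "0 < s" "s \<le> t"
  shows "rr f t \<le> rr f s"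
  unfolding rr_def using carrier_finite[OF assms(1,2)]
  by (intro enn2real_mono antimono_rearrangement assms) simp

text \<open>A smaller distribution function gives a smaller rearrangement, and \<rho> is monotone.
  This is the form in which rearrangement invariance enters.\<close>

lemma carrier_mono_distribution:
  assumes f: "f \<in> qcarrier E" and [measurable]: "g \<in> borel_measurable (leb L)"
    and le: "\<And>l. 0 \<le> l \<Longrightarrow> distribution L g l \<le> distribution L f l"
  shows "g \<in> qcarrier E" "qnorm E g \<le> qnorm E f"
proof -
  note [measurable] = carrier_measurable[OF f]
  have le': "rearrangement L g t \<le> rearrangement L f t" for t
    by (rule rearrangement_mono_measure[OF le])
  have "\<rho> (\<lambda>t. complex_of_real (rr g t)) \<le> \<rho> (\<lambda>t. complex_of_real (rr f t))"
    using carrier_finite[OF f]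
    by (intro rho_mono rr_measurable_leb carrier_measurable[OF f] assms(2))
       (auto simp: rr_def space_leb intro!: enn2real_mono le')
  then have le'': "\<rho> (\<lambda>t. complex_of_real (rr g t)) \<le> ennreal (qnorm E f)"
    using ennreal_qnorm[OF f] by simp
  show g: "g \<in> qcarrier E"
  proof (rule carrierI)
    show "rearrangement L g t < \<infinity>" if "t \<in> space (leb L)" for t
      using le'[of t] carrier_finite[OF f, of t] that by (auto simp: space_leb)
    show "\<rho> (\<lambda>t. complex_of_real (rr g t)) < \<infinity>"
      using le'' by (auto simp: less_top[symmetric] top_unique)
  qed fact
  show "qnorm E g \<le> qnorm E f"
    using le'' ennreal_qnorm(2)[OF f] by (simp flip: ennreal_qnorm(1)[OF g])
qed

text \<open>If r is the finite measure of {|f| > l}, then \<open>rr f (2 * x / 3) > l\<close> forces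
  x < 3r/2, and each dyadic part occupies at most 2/3 of (0, 3r/2), that is, at most r. So both
  pieces \<open>h b\<close> of the dilate have norm at most that of \<open>f\<close>, and
  \<open>B = 2 * C\<close> comes from adding them. The dilate is decreasing and right-continuous,
  hence equals its own rearrangement on (0,L).\<close>

lemma dilation_step:
  obtains B where "1 \<le> B" and "\<And>f. f \<in> qcarrier E \<Longrightarrow>
    \<exists>g\<in>qcarrier E. (\<forall>t\<in>space (leb L). rr g t = rr f (2 * t / 3)) \<and> qnorm E g \<le> B * qnorm E f"
proof -
  obtain C where C: "1 \<le> C" "\<And>f g. f \<in> qcarrier E \<Longrightarrow> g \<in> qcarrier E \<Longrightarrow>
      f + g \<in> qcarrier E \<and> qnorm E (f + g) \<le> C * (qnorm E f + qnorm E g)"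
    by (rule qnorm_triangle) blast
  have "\<exists>g\<in>qcarrier E. (\<forall>t\<in>space (leb L). rr g t = rr f (2 * t / 3)) \<and>
      qnorm E g \<le> (2 * C) * qnorm E f" if f: "f \<in> qcarrier E" for f
  proof -
    note [measurable] = carrier_measurable[OF f]
    define h where "h b x = complex_of_real (rr f (2 * x / 3) * indicator (dyadic_part b) x)" for b x
    have h_measurable[measurable]: "h b \<in> borel_measurable (leb L)" for b
      unfolding h_def by (intro borel_measurable_leb) measurable
    have level: "rr f (2 * x / 3) > l \<longleftrightarrow> ennreal (2 * x / 3) < distribution L f l"
      if "0 < x" "0 \<le> l" for x l
      using rr_le_iff[OF f, of "2 * x / 3" l] that by (auto simp: not_le[symmetric])
    have h_le: "distribution L (h b) l \<le> distribution L f l" if "0 \<le> l" for b l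
    proof (cases "distribution L f l")
      case (real r)
      have "distribution L (h b) l \<le> emeasure (leb L) (space (leb L) \<inter> (dyadic_part b \<inter> {0<..<3 * r / 2}))"
        unfolding distribution_def
      proof (rule emeasure_mono)
        show "{x \<in> space (leb L). l < cmod (h b x)} \<subseteq>
            space (leb L) \<inter> (dyadic_part b \<inter> {0<..<3 * r / 2})"
        proof
          fix x assume x: "x \<in> {x \<in> space (leb L). l < cmod (h b x)}"
          then have "0 < x" by (simp add: space_leb)
          have "x \<in> dyadic_part b" "l < rr f (2 * x / 3)"
            using x \<open>0 \<le> l\<close> by (cases "x \<in> dyadic_part b"; simp add: h_def)+
          moreover from this have "2 * x / 3 < r"
            using level[OF \<open>0 < x\<close> \<open>0 \<le> l\<close>] real \<open>0 < x\<close> by (simp add: ennreal_less_iff)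
          ultimately show "x \<in> space (leb L) \<inter> (dyadic_part b \<inter> {0<..<3 * r / 2})"
            using x \<open>0 < x\<close> by simp
        qed
        show "space (leb L) \<inter> (dyadic_part b \<inter> {0<..<3 * r / 2}) \<in> sets (leb L)"
          using interval_borel[of L] by (intro sets_leb) (auto simp: space_leb)
      qed
      also have "\<dots> = emeasure lborel (space (leb L) \<inter> (dyadic_part b \<inter> {0<..<3 * r / 2}))"
        using interval_borel[of L] by (intro emeasure_leb) (auto simp: space_leb)
      also have "\<dots> \<le> emeasure lborel (dyadic_part b \<inter> {0<..<3 * r / 2})"
        by (intro emeasure_mono) auto
      also have "\<dots> \<le> ennreal r"
        using emeasure_dyadic_part[of "3 * r / 2" b] real by simp
      finally show ?thesis using real by simp
    qed simp
    note h_carrier = carrier_mono_distribution[OF f h_measurable h_le]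
    define g where "g = h True + h False"
    have g: "g \<in> qcarrier E" and "qnorm E g \<le> C * (qnorm E (h True) + qnorm E (h False))"
      using C(2)[of "h True" "h False"] h_carrier(1) by (auto simp: g_def)
    note this(2)
    also have "\<dots> \<le> C * (qnorm E f + qnorm E f)"
      using C(1) h_carrier(2) by (intro mult_left_mono add_mono) auto
    finally have g_le: "qnorm E g \<le> (2 * C) * qnorm E f" by simp
    have cmod_g: "cmod (g x) = rr f (2 * x / 3)" if "0 < x" for x
      using that by (auto simp: g_def h_def dyadic_part_def indicator_def)
    have "rr g t = rr f (2 * t / 3)" if t: "t \<in> space (leb L)" for t
    proof -
      have "0 < t" "ereal t < L" using t by (auto simp: space_leb)
      \<comment> \<open>Two nonnegative reals with the same nonnegative upper bounds are equal; each
        of them is inserted for \<open>l\<close> afterwards.\<close>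
      have "rr g t \<le> l \<longleftrightarrow> rr f (2 * t / 3) \<le> l" if "0 \<le> l" for l
      proof -
        define d where "d = distribution L f l"
        have set_eq: "{x \<in> space (leb L). cmod (g x) > l} = {x \<in> space (leb L). ennreal (2 * x / 3) < d}"
          using level[OF _ that] by (auto simp: space_leb cmod_g d_def)
        have "distribution L g l \<le> ennreal t \<longleftrightarrow> d \<le> ennreal (2 * t / 3)"
        proof
          assume "d \<le> ennreal (2 * t / 3)"
          have "{x \<in> space (leb L). cmod (g x) > l} \<subseteq> {0<..<t}"
          proof
            fix x assume x: "x \<in> {x \<in> space (leb L). cmod (g x) > l}"
            then have "ennreal (2 * x / 3) < ennreal (2 * t / 3)"
              unfolding set_eq using \<open>d \<le> ennreal (2 * t / 3)\<close> by auto
            then show "x \<in> {0<..<t}"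
              using x by (auto simp: space_leb ennreal_less_iff)
          qed
          moreover have "{0<..<t} \<in> sets (leb L)"
            using \<open>ereal t < L\<close> by (intro sets_leb) (auto simp: space_leb intro: less_trans[of "ereal _" "ereal t"])
          ultimately have "distribution L g l \<le> emeasure (leb L) {0<..<t}"
            unfolding distribution_def by (rule emeasure_mono)
          also have "\<dots> = ennreal t"
            using \<open>0 < t\<close> \<open>ereal t < L\<close> by (intro emeasure_leb_greaterThanLessThan) auto
          finally show "distribution L g l \<le> ennreal t" .
        next
          assume *: "distribution L g l \<le> ennreal t"
          show "d \<le> ennreal (2 * t / 3)"
          proof (rule ccontr)
            assume "\<not> d \<le> ennreal (2 * t / 3)"
            then have "ennreal (2 * t / 3) < d" by simp
            then obtain r where r: "2 * t / 3 < r" "ennreal r \<le> d"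
            proof (cases d)
              case (real r)
              then show ?thesis using \<open>ennreal (2 * t / 3) < d\<close> \<open>0 < t\<close> that[of r]
                by (simp add: ennreal_less_iff)
            next
              case top
              then show ?thesis using that[of "2 * t / 3 + 1"] by simp
            qed
            \<comment> \<open>As \<open>t\<close> lies strictly below \<open>L\<close>, there is
              room for an interval (0,s) in (0,L) with \<open>s > t\<close> on which 2x/3 stays
              below \<open>r\<close>. It lies in the superlevel set of \<open>g\<close>, whose
              measure then exceeds \<open>t\<close>.\<close>
            obtain s' where s': "ereal t < ereal s'" "ereal s' < L"
              using ereal_dense2[OF \<open>ereal t < L\<close>] by auto
            define s where "s = min s' (3 * r / 2)"
            have s: "t < s" "ereal s \<le> L" "2 * s / 3 \<le> r"
              using s' r by (auto simp: s_def min_def intro: less_imp_le order_trans[of _ "ereal s'"])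
            have "{0<..<s} \<subseteq> {x \<in> space (leb L). cmod (g x) > l}"
              unfolding set_eq
            proof
              fix x assume x: "x \<in> {0<..<s}"
              then have "ereal x < L" using s(2) by (auto intro: less_le_trans[of "ereal x" "ereal s"])
              moreover have "ennreal (2 * x / 3) < ennreal r"
                using x s(3) by (intro ennreal_lessI) auto
              ultimately show "x \<in> {x \<in> space (leb L). ennreal (2 * x / 3) < d}"
                using x r(2) by (auto simp: space_leb)
            qed
            then have "emeasure (leb L) {0<..<s} \<le> distribution L g l"
              unfolding distribution_def using carrier_measurable[OF g]
              by (intro emeasure_mono) measurable
            moreover have "emeasure (leb L) {0<..<s} = ennreal s"
              using s \<open>0 < t\<close> by (intro emeasure_leb_greaterThanLessThan) auto
            ultimately have "ennreal s \<le> ennreal t" using * by simp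
            then show False using s \<open>0 < t\<close> by simp
          qed
        qed
        then show ?thesis
          using rr_le_iff[OF g \<open>0 < t\<close> that] rr_le_iff[OF f, of "2 * t / 3" l] that \<open>0 < t\<close>
          by (simp add: d_def)
      qed
      from this[of "rr g t"] this[of "rr f (2 * t / 3)"] show ?thesis by simp
    qed
    then show ?thesis using g g_le by blast
  qed
  then show thesis using that[of "2 * C"] C(1) by simp
qed

text \<open>Each of the \<open>k\<close> applications of \<open>dilation_step\<close> costs a factor
  \<open>B\<close>. The identity for \<open>rr\<close> is known only on (0,L), which contraction by
  2/3 maps into itself, so it can be iterated.\<close>

lemma rho_dilation:
  obtains B where "1 \<le> B" and "\<And>f k. f \<in> qcarrier E \<Longrightarrow>
    \<rho> (\<lambda>t. complex_of_real (rr f ((2 / 3) ^ k * t))) \<le> ennreal (B ^ k * qnorm E f)"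
proof -
  obtain B where B: "1 \<le> B" "\<And>f. f \<in> qcarrier E \<Longrightarrow>
    \<exists>g\<in>qcarrier E. (\<forall>t\<in>space (leb L). rr g t = rr f (2 * t / 3)) \<and> qnorm E g \<le> B * qnorm E f"
    by (rule dilation_step) blast
  have iter: "\<exists>g\<in>qcarrier E. (\<forall>t\<in>space (leb L). rr g t = rr f ((2 / 3) ^ k * t)) \<and>
      qnorm E g \<le> B ^ k * qnorm E f" if f: "f \<in> qcarrier E" for f k
  proof (induction k)
    case 0
    then show ?case using f by auto
  next
    case (Suc k)
    then obtain g where g: "g \<in> qcarrier E" "\<forall>t\<in>space (leb L). rr g t = rr f ((2 / 3) ^ k * t)"
        "qnorm E g \<le> B ^ k * qnorm E f" by blast
    obtain g' where g': "g' \<in> qcarrier E" "\<forall>t\<in>space (leb L). rr g' t = rr g (2 * t / 3)"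
        "qnorm E g' \<le> B * qnorm E g" using B(2)[OF g(1)] by blast
    have "rr g' t = rr f ((2 / 3) ^ Suc k * t)" if "t \<in> space (leb L)" for t
    proof -
      have "2 * t / 3 \<in> space (leb L)"
        using that by (auto simp: space_leb intro: le_less_trans[of _ "ereal t"])
      then have "rr g' t = rr f ((2 / 3) ^ k * (2 * t / 3))" using g(2) g'(2) that by simp
      then show ?thesis by (simp add: field_simps)
    qed
    moreover have "qnorm E g' \<le> B ^ Suc k * qnorm E f"
      using order_trans[OF g'(3) mult_left_mono[OF g(3), of B]] B(1) by (simp add: mult.assoc)
    ultimately show ?case using g'(1) by blast
  qed
  have "\<rho> (\<lambda>t. complex_of_real (rr f ((2 / 3) ^ k * t))) \<le> ennreal (B ^ k * qnorm E f)"
    if f: "f \<in> qcarrier E" for f k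
  proof -
    obtain g where g: "g \<in> qcarrier E" "\<forall>t\<in>space (leb L). rr g t = rr f ((2 / 3) ^ k * t)"
        "qnorm E g \<le> B ^ k * qnorm E f" using iter[OF f] by blast
    note [measurable] = carrier_measurable[OF f] carrier_measurable[OF g(1)]
    have "(\<lambda>t. rr f ((2 / 3) ^ k * t)) \<in> borel_measurable (leb L)"
      by (intro borel_measurable_leb) measurable
    then have "\<rho> (\<lambda>t. complex_of_real (rr f ((2 / 3) ^ k * t))) = ennreal (qnorm E g)"
      unfolding ennreal_qnorm(1)[OF g(1)] using g(2) by (intro rho_cong) auto
    then show ?thesis using g(3) by (simp add: ennreal_leI)
  qed
  then show thesis using that[of B] B(1) by blast
qed

section \<open>Series of dilates with geometric weights\<close>

lemma rho_sum:
  assumes C: "1 \<le> C" "\<And>f g. f \<in> borel_measurable (leb L) \<Longrightarrow> g \<in> borel_measurable (leb L) \<Longrightarrow>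
      \<rho> (\<lambda>t. complex_of_real (f t + g t)) \<le>
      ennreal C * (\<rho> (\<lambda>t. complex_of_real (f t)) + \<rho> (\<lambda>t. complex_of_real (g t)))"
    and "\<And>k. g k \<in> borel_measurable (leb L)"
  shows "\<rho> (\<lambda>t. complex_of_real (\<Sum>k<n. g k t)) \<le>
    (\<Sum>k<n. ennreal (C ^ Suc k) * \<rho> (\<lambda>t. complex_of_real (g k t)))"
  using assms(3)
proof (induction n arbitrary: g)
  case 0
  show ?case using rho_scale[of "\<lambda>t. 0" 0] by simp
next
  case (Suc n)
  note [measurable] = Suc.prems
  \<comment> \<open>Splitting off the first term lets the triangle constant accumulate on later
    terms only. The factor of term \<open>k\<close> is then independent of \<open>n\<close> and can
    be absorbed by geometric weights.\<close>
  have "\<rho> (\<lambda>t. complex_of_real (\<Sum>k<Suc n. g k t)) =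
      \<rho> (\<lambda>t. complex_of_real (g 0 t + (\<Sum>k<n. g (Suc k) t)))"
    by (simp only: sum.lessThan_Suc_shift)
  also have "\<dots> \<le> ennreal C * (\<rho> (\<lambda>t. complex_of_real (g 0 t)) +
      \<rho> (\<lambda>t. complex_of_real (\<Sum>k<n. g (Suc k) t)))"
    by (intro C(2)) measurable
  also have "\<dots> \<le> ennreal C * (\<rho> (\<lambda>t. complex_of_real (g 0 t)) +
      (\<Sum>k<n. ennreal (C ^ Suc k) * \<rho> (\<lambda>t. complex_of_real (g (Suc k) t))))"
    by (intro mult_left_mono add_left_mono Suc.IH Suc.prems) auto
  also have "\<dots> = (\<Sum>k<Suc n. ennreal (C ^ Suc k) * \<rho> (\<lambda>t. complex_of_real (g k t)))"
    using C(1) unfolding sum.lessThan_Suc_shift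
    by (simp add: distrib_left sum_distrib_left ennreal_mult mult.assoc)
  finally show ?case .
qed

text \<open>With \<open>B\<close> from dilations and \<open>C\<close> from the triangle inequality,
  term \<open>k\<close> contributes at most C^(k+1) q^k B^k times the norm of \<open>f\<close>. The
  choice of \<open>q\<close> makes this \<open>C\<close> times 2^(-k), so all partial sums are
  bounded with \<open>M = 2 * C\<close>, and the Fatou property passes to the limit.\<close>

lemma dilation_series:
  obtains q M where "0 < q" "q < 1" "0 < M"
    and "\<And>f t. f \<in> qcarrier E \<Longrightarrow> t \<in> space (leb L) \<Longrightarrow> summable (\<lambda>k. q ^ k * rr f ((2 / 3) ^ k * t))"
    and "\<And>f. f \<in> qcarrier E \<Longrightarrow>
      \<rho> (\<lambda>t. complex_of_real (\<Sum>k. q ^ k * rr f ((2 / 3) ^ k * t))) \<le> ennreal (M * qnorm E f)"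
proof -
  obtain B where B: "1 \<le> B" "\<And>f k. f \<in> qcarrier E \<Longrightarrow>
    \<rho> (\<lambda>t. complex_of_real (rr f ((2 / 3) ^ k * t))) \<le> ennreal (B ^ k * qnorm E f)"
    by (rule rho_dilation) blast
  obtain C where C: "1 \<le> C" "\<And>f g. f \<in> borel_measurable (leb L) \<Longrightarrow> g \<in> borel_measurable (leb L) \<Longrightarrow>
      \<rho> (\<lambda>t. complex_of_real (f t + g t)) \<le>
      ennreal C * (\<rho> (\<lambda>t. complex_of_real (f t)) + \<rho> (\<lambda>t. complex_of_real (g t)))"
    by (rule rho_triangle) blast
  define q where "q = 1 / (2 * B * C)"
  have BC: "1 \<le> B * C" using mult_mono[of 1 B 1 C] B(1) C(1) by simp
  have "0 < q" "q < 1" "C * (q * B) = 1 / 2"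
    using B(1) C(1) BC by (auto simp: q_def field_simps)
  have qB: "q * B \<le> 1 / 2"
    using B(1) C(1) by (simp add: q_def)
  \<comment> \<open>The Fatou property needs a real-valued limit function, so the series must
    converge at each point of (0,L).\<close>
  have summable: "summable (\<lambda>k. q ^ k * rr f ((2 / 3) ^ k * t))"
    if f: "f \<in> qcarrier E" and t: "t \<in> space (leb L)" for f t
  proof -
    note [measurable] = carrier_measurable[OF f]
    have "0 < t" "ereal t \<le> L" using t by (auto simp: space_leb)
    from rho_indicator_pos[OF this]
    obtain d where d: "0 < d" "ennreal d \<le> \<rho> (\<lambda>x. complex_of_real (indicator {0<..<t} x))"
    proof (cases "\<rho> (\<lambda>x. complex_of_real (indicator {0<..<t} x))")
      case (real r)
      then show ?thesis using that[of r] rho_indicator_pos[OF \<open>0 < t\<close> \<open>ereal t \<le> L\<close>] by auto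
    qed (use that[of 1] in simp)
    \<comment> \<open>On (0,t) the decreasing function x \<mapsto>
      \<open>rr f ((2 / 3) ^ k * x)\<close> is at least its value at \<open>t\<close>, so it
      dominates that value times the indicator, whose \<rho> is at least \<open>d\<close>.\<close>
    have bound: "rr f ((2 / 3) ^ k * t) * d \<le> B ^ k * qnorm E f" for k
    proof -
      let ?c = "rr f ((2 / 3) ^ k * t)"
      have "ennreal (?c * d) \<le> ennreal ?c * \<rho> (\<lambda>x. complex_of_real (indicator {0<..<t} x))"
        using d by (simp add: ennreal_mult mult_left_mono)
      also have "\<dots> = \<rho> (\<lambda>x. complex_of_real (?c * indicator {0<..<t} x))"
        by (intro rho_scale[symmetric] borel_measurable_leb) auto
      also have "\<dots> \<le> \<rho> (\<lambda>x. complex_of_real (rr f ((2 / 3) ^ k * x)))"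
      proof (rule rho_mono)
        show "\<bar>?c * indicator {0<..<t} x\<bar> \<le> \<bar>rr f ((2 / 3) ^ k * x)\<bar>" for x
          using rr_antimono[OF f, of "(2 / 3) ^ k * x" "(2 / 3) ^ k * t"]
          by (auto simp: indicator_def)
      qed (auto intro!: borel_measurable_leb)
      also have "\<dots> \<le> ennreal (B ^ k * qnorm E f)" by (rule B(2)[OF f])
      finally show ?thesis
        using B(1) ennreal_qnorm(2)[OF f] by (subst (asm) ennreal_le_iff) auto
    qed
    show ?thesis
    proof (rule summable_comparison_test')
      show "summable (\<lambda>k. (1 / 2) ^ k * (qnorm E f / d))"
        by (intro summable_mult2 summable_geometric) simp
      show "norm (q ^ k * rr f ((2 / 3) ^ k * t)) \<le> (1 / 2) ^ k * (qnorm E f / d)" if "k \<ge> 0" for k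
      proof -
        have "q ^ k * rr f ((2 / 3) ^ k * t) \<le> q ^ k * (B ^ k * qnorm E f / d)"
          using bound[of k] d(1) \<open>0 < q\<close> by (intro mult_left_mono) (auto simp: field_simps)
        also have "\<dots> = (q * B) ^ k * (qnorm E f / d)" by (simp add: power_mult_distrib)
        also have "\<dots> \<le> (1 / 2) ^ k * (qnorm E f / d)"
          using qB \<open>0 < q\<close> B(1) d(1) ennreal_qnorm(2)[OF f]
          by (intro mult_right_mono power_mono) auto
        finally show ?thesis using \<open>0 < q\<close> by (simp add: abs_mult)
      qed
    qed
  qed
  have "\<rho> (\<lambda>t. complex_of_real (\<Sum>k. q ^ k * rr f ((2 / 3) ^ k * t))) \<le> ennreal ((2 * C) * qnorm E f)"
    if f: "f \<in> qcarrier E" for f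
  proof -
    note [measurable] = carrier_measurable[OF f]
    define a where "a k t = q ^ k * rr f ((2 / 3) ^ k * t)" for k t
    have a_measurable[measurable]: "a k \<in> borel_measurable (leb L)" for k
      unfolding a_def by (intro borel_measurable_leb) measurable
    have a_nonneg: "0 \<le> a k t" for k t using \<open>0 < q\<close> by (simp add: a_def)
    have rho_a: "ennreal (C ^ Suc k) * \<rho> (\<lambda>t. complex_of_real (a k t)) \<le>
        ennreal ((1 / 2) ^ k * (C * qnorm E f))" for k
    proof -
      have "\<rho> (\<lambda>t. complex_of_real (a k t)) = ennreal (q ^ k) * \<rho> (\<lambda>t. complex_of_real (rr f ((2 / 3) ^ k * t)))"
        unfolding a_def using \<open>0 < q\<close> by (intro rho_scale borel_measurable_leb) auto
      also have "\<dots> \<le> ennreal (q ^ k) * ennreal (B ^ k * qnorm E f)"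
        by (intro mult_left_mono B(2) f) auto
      finally have "ennreal (C ^ Suc k) * \<rho> (\<lambda>t. complex_of_real (a k t)) \<le>
          ennreal (C ^ Suc k) * (ennreal (q ^ k) * ennreal (B ^ k * qnorm E f))"
        by (intro mult_left_mono) auto
      also have "\<dots> = ennreal (C ^ Suc k * (q ^ k * (B ^ k * qnorm E f)))"
        using C(1) B(1) \<open>0 < q\<close> ennreal_qnorm(2)[OF f] by (simp add: ennreal_mult)
      also have "C ^ Suc k * (q ^ k * (B ^ k * qnorm E f)) = (C * (q * B)) ^ k * (C * qnorm E f)"
        by (simp add: power_mult_distrib)
      finally show ?thesis unfolding \<open>C * (q * B) = 1 / 2\<close> .
    qed
    have partial: "\<rho> (\<lambda>t. complex_of_real (\<Sum>k<n. a k t)) \<le> ennreal ((2 * C) * qnorm E f)" for n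
    proof -
      have "\<rho> (\<lambda>t. complex_of_real (\<Sum>k<n. a k t)) \<le>
          (\<Sum>k<n. ennreal (C ^ Suc k) * \<rho> (\<lambda>t. complex_of_real (a k t)))"
        by (intro rho_sum C a_measurable)
      also have "\<dots> \<le> (\<Sum>k<n. ennreal ((1 / 2) ^ k * (C * qnorm E f)))"
        by (intro sum_mono rho_a)
      also have "\<dots> = ennreal ((\<Sum>k<n. (1 / 2) ^ k) * (C * qnorm E f))"
        using C(1) ennreal_qnorm(2)[OF f] by (subst sum_ennreal) (auto simp: sum_distrib_right)
      also have "\<dots> \<le> ennreal (2 * (C * qnorm E f))"
      proof (intro ennreal_leI mult_right_mono)
        show "(\<Sum>k<n. (1 / 2) ^ k) \<le> (2::real)"
          by (simp add: sum_gp_strict)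
      qed (use C(1) ennreal_qnorm(2)[OF f] in auto)
      finally show ?thesis by (simp add: mult.assoc)
    qed
    have "(\<lambda>n. \<rho> (\<lambda>t. complex_of_real (\<Sum>k<n. a k t))) \<longlonglongrightarrow> \<rho> (\<lambda>t. complex_of_real (\<Sum>k. a k t))"
    proof -
      have fatou: "(\<lambda>n. \<rho> (\<lambda>x. complex_of_real (u n x))) \<longlonglongrightarrow> \<rho> (\<lambda>x. complex_of_real (v x))"
        if "\<And>n. u n \<in> borel_measurable (leb L)" "v \<in> borel_measurable (leb L)"
          "AE x in leb L. (\<forall>n. 0 \<le> u n x) \<and> incseq (\<lambda>n. u n x) \<and> (\<lambda>n. u n x) \<longlonglongrightarrow> v x"
        for u :: "nat \<Rightarrow> real \<Rightarrow> real" and v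
        using rho_axioms that unfolding rho_axioms_def by blast
      show ?thesis
      proof (rule fatou)
        show "AE x in leb L. (\<forall>n. 0 \<le> (\<Sum>k<n. a k x)) \<and> incseq (\<lambda>n. \<Sum>k<n. a k x) \<and>
            (\<lambda>n. \<Sum>k<n. a k x) \<longlonglongrightarrow> (\<Sum>k. a k x)"
        proof (rule AE_I2, intro conjI allI)
          fix x assume "x \<in> space (leb L)"
          then show "(\<lambda>n. \<Sum>k<n. a k x) \<longlonglongrightarrow> (\<Sum>k. a k x)"
            using summable[OF f] by (auto simp: a_def intro: summable_LIMSEQ)
        qed (auto intro!: sum_nonneg incseq_SucI simp: a_nonneg)
      qed measurable
    qed
    then show ?thesis unfolding a_def[symmetric]
      by (rule LIMSEQ_le_const2) (use partial in auto)
  qed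
  then show thesis
    using \<open>0 < q\<close> \<open>q < 1\<close> summable C(1) by (intro that[of q "2 * C"]) auto
qed

subsection \<open>Comparison of the two norms\<close>

text \<open>The set \<open>A k\<close> where |f| exceeds \<open>lam k\<close> has measure at most
  (2/3)^k t. A point of \<open>A m\<close> at which |f| \<le> \<open>lam (Suc m)\<close> is paid for
  by the m-th summand, and \<open>S\<close> bounds \<open>lam (Suc k)\<close> by S / q^(k+1). Since
  q^p = 5/6, the growth of lam^p is slower than the decay of the measures.\<close>

lemma nn_integral_above_rearrangement:
  assumes f: "f \<in> qcarrier E" and "0 < p" "0 < q" and q: "q powr p = 5 / 6"
    and t: "0 < t" and S: "\<And>k. q ^ k * rr f ((2 / 3) ^ k * t) \<le> S"
  shows "(\<integral>\<^sup>+x. ennreal (cmod (if cmod (f x) > rr f t then f x else 0) powr p) \<partial>leb L) \<le>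
    ennreal (6 * t * (S / q) powr p)"
proof -
  note [measurable] = carrier_measurable[OF f]
  define lam where "lam k = rr f ((2 / 3) ^ k * t)" for k
  define A where "A k = {x \<in> space (leb L). cmod (f x) > lam k}" for k
  have [measurable]: "A k \<in> sets (leb L)" for k unfolding A_def by measurable
  have lam_nonneg: "0 \<le> lam k" for k by (simp add: lam_def)
  have A_le: "emeasure (leb L) (A k) \<le> ennreal ((2 / 3) ^ k * t)" for k
    using rr_le_iff[OF f, of "(2 / 3) ^ k * t" "lam k"] t by (simp add: A_def distribution_def lam_def)
  have single_le: "g m \<le> suminf g" for g :: "nat \<Rightarrow> ennreal" and m
    using sum_le_suminf[OF summableI, of "{m}" g] by simp
  \<comment> \<open>Outside this null set some height \<open>lam k\<close> is not exceeded, so a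
    least such index exists.\<close>
  have "AE x in leb L. x \<notin> (\<Inter>k. A k)"
  proof (rule AE_not_in, rule null_setsI)
    have "(\<lambda>k. ennreal ((2 / 3) ^ k * t)) \<longlonglongrightarrow> ennreal (0 * t)"
      by (intro tendsto_ennrealI tendsto_mult LIMSEQ_power_zero tendsto_const) simp
    moreover have "emeasure (leb L) (\<Inter>k. A k) \<le> ennreal ((2 / 3) ^ k * t)" for k
      by (rule order_trans[OF emeasure_mono A_le[of k]]) auto
    ultimately have "emeasure (leb L) (\<Inter>k. A k) \<le> ennreal (0 * t)"
      by (intro LIMSEQ_le_const) auto
    then show "emeasure (leb L) (\<Inter>k. A k) = 0" by simp
  qed measurable
  then have "AE x in leb L. ennreal (cmod (if cmod (f x) > rr f t then f x else 0) powr p) \<le>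
      (\<Sum>k. ennreal (lam (Suc k) powr p) * indicator (A k) x)"
    using AE_space
  proof eventually_elim
    case (elim x)
    show ?case
    proof (cases "cmod (f x) > rr f t")
      case True
      obtain k where "cmod (f x) \<le> lam k" using elim by (auto simp: A_def not_less)
      define n where "n = (LEAST k. cmod (f x) \<le> lam k)"
      have n: "cmod (f x) \<le> lam n" unfolding n_def by (rule LeastI) fact
      have "n \<noteq> 0" using n True by (auto simp: lam_def intro!: gr0I)
      then obtain m where m: "n = Suc m" by (cases n) auto
      have "\<not> cmod (f x) \<le> lam m" using not_less_Least[of m "\<lambda>k. cmod (f x) \<le> lam k"] m by (simp add: n_def)
      then have "x \<in> A m" using elim by (simp add: A_def)
      have "ennreal (cmod (f x) powr p) \<le> ennreal (lam (Suc m) powr p) * indicator (A m) x"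
        using n \<open>0 < p\<close> \<open>x \<in> A m\<close> by (simp add: m ennreal_leI powr_mono2)
      also have "\<dots> \<le> (\<Sum>k. ennreal (lam (Suc k) powr p) * indicator (A k) x)"
        using single_le[of "\<lambda>k. ennreal (lam (Suc k) powr p) * indicator (A k) x" m] .
      finally show ?thesis using True by simp
    qed (use \<open>0 < p\<close> in simp)
  qed
  then have "(\<integral>\<^sup>+x. ennreal (cmod (if cmod (f x) > rr f t then f x else 0) powr p) \<partial>leb L) \<le>
      (\<integral>\<^sup>+x. (\<Sum>k. ennreal (lam (Suc k) powr p) * indicator (A k) x) \<partial>leb L)"
    by (rule nn_integral_mono_AE)
  also have "\<dots> = (\<Sum>k. ennreal (lam (Suc k) powr p) * emeasure (leb L) (A k))"
    by (subst nn_integral_suminf) (auto simp: nn_integral_cmult_indicator)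
  also have "\<dots> \<le> (\<Sum>k. ennreal ((5 / 6) ^ k * (t * (S / q) powr p)))"
  proof (intro suminf_le summableI)
    fix k
    have "lam (Suc k) \<le> S / q / q ^ k"
      using S[of "Suc k"] \<open>0 < q\<close> by (simp add: lam_def field_simps)
    then have "lam (Suc k) powr p \<le> (S / q / q ^ k) powr p"
      using \<open>0 < p\<close> by (intro powr_mono2 lam_nonneg) auto
    also have "\<dots> = (S / q) powr p / (q ^ k) powr p"
      by (rule powr_divide)
    also have "(q ^ k) powr p = (5 / 6) ^ k"
      using \<open>0 < q\<close> by (simp add: q[symmetric] powr_powr powr_realpow[symmetric] mult.commute)
    finally have "lam (Suc k) powr p * ((2 / 3) ^ k * t) \<le> (S / q) powr p / (5 / 6) ^ k * ((2 / 3) ^ k * t)"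
      using t by (intro mult_right_mono) auto
    \<comment> \<open>The ratio is (2/3)/(5/6) = 4/5; it is then enlarged to 5/6, whose geometric
      series sums to the factor 6 of the statement.\<close>
    also have "\<dots> = (4 / 5) ^ k * (t * (S / q) powr p)"
      by (simp add: power_divide field_simps flip: power_mult_distrib)
    also have "\<dots> \<le> (5 / 6) ^ k * (t * (S / q) powr p)"
      using t by (intro mult_right_mono power_mono) auto
    finally have "ennreal (lam (Suc k) powr p * ((2 / 3) ^ k * t)) \<le> ennreal ((5 / 6) ^ k * (t * (S / q) powr p))"
      by (rule ennreal_leI)
    moreover have "ennreal (lam (Suc k) powr p) * emeasure (leb L) (A k) \<le>
        ennreal (lam (Suc k) powr p) * ennreal ((2 / 3) ^ k * t)"
      by (intro mult_left_mono A_le) auto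
    ultimately show "ennreal (lam (Suc k) powr p) * emeasure (leb L) (A k) \<le>
        ennreal ((5 / 6) ^ k * (t * (S / q) powr p))"
      using t by (simp add: ennreal_mult)
  qed
  also have "\<dots> = ennreal (6 * (t * (S / q) powr p))"
  proof -
    have "(\<lambda>k. (5 / 6) ^ k * (t * (S / q) powr p)) sums ((1 / (1 - 5 / 6)) * (t * (S / q) powr p))"
      by (intro sums_mult2 geometric_sums) simp
    then show ?thesis using t by (intro suminf_ennreal_eq) auto
  qed
  finally show ?thesis by (simp add: mult.assoc)
qed

text \<open>Cut \<open>f\<close> at height \<open>rr f t\<close>. The upper part has L_p norm at
  most (6t)^(1/p) S/q by the preceding estimate; the rest is bounded by \<open>rr f t\<close>, which
  is at most \<open>S\<close> by the term \<open>k = 0\<close>. Both contributions scale like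
  t^(1/p), which the prefactor removes.\<close>

lemma K_functional_le_series:
  assumes f: "f \<in> qcarrier E" and "0 < p" "0 < q" and q: "q powr p = 5 / 6"
    and t: "t \<in> space (leb L)" and S: "\<And>k. q ^ k * rr f ((2 / 3) ^ k * t) \<le> S"
  shows "f \<in> sum_space (Lp L (ereal p)) (Lp L \<infinity>)"
    and "t powr (- 1 / p) * K_functional (t powr (1 / p)) f (Lp L (ereal p)) (Lp L \<infinity>) \<le>
      (6 powr (1 / p) / q + 1) * S"
proof -
  note [measurable] = carrier_measurable[OF f]
  have "0 < t" using t by (simp add: space_leb)
  have S0: "rr f t \<le> S" using S[of 0] by simp
  then have "0 \<le> S" by (rule order_trans[OF rr_nonneg])
  define f0 where "f0 x = (if cmod (f x) > rr f t then f x else 0)" for x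
  define f1 where "f1 x = (if cmod (f x) > rr f t then 0 else f x)" for x
  have [measurable]: "f0 \<in> borel_measurable (leb L)" "f1 \<in> borel_measurable (leb L)"
    unfolding f0_def f1_def by measurable
  have split: "f = f0 + f1" by (auto simp: f0_def f1_def)
  have f0: "f0 \<in> qcarrier (Lp L (ereal p))"
    "qnorm (Lp L (ereal p)) f0 \<le> (6 * t * (S / q) powr p) powr (1 / p)"
    using nn_integral_above_rearrangement[OF f \<open>0 < p\<close> \<open>0 < q\<close> q \<open>0 < t\<close> S] \<open>0 < p\<close> \<open>0 < t\<close>
    by (intro LpI; simp flip: f0_def)+
  have f1: "f1 \<in> qcarrier (Lp L \<infinity>)" "qnorm (Lp L \<infinity>) f1 \<le> rr f t"
    by (intro Lp_topI[where c = "rr f t"] L_pos; simp add: f1_def)+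
  show "f \<in> sum_space (Lp L (ereal p)) (Lp L \<infinity>)"
    unfolding sum_space_def using split f0(1) f1(1) by blast
  have "K_functional (t powr (1 / p)) f (Lp L (ereal p)) (Lp L \<infinity>) \<le>
      qnorm (Lp L (ereal p)) f0 + t powr (1 / p) * qnorm (Lp L \<infinity>) f1"
    unfolding split by (intro K_functional_le f0 f1 Lp_norm_nonneg Lp_top_norm(1) L_pos) auto
  also have "\<dots> \<le> (6 * t * (S / q) powr p) powr (1 / p) + t powr (1 / p) * S"
    using f0(2) f1(2) S0 by (intro add_mono mult_left_mono) auto
  also have "(6 * t * (S / q) powr p) powr (1 / p) = t powr (1 / p) * (6 powr (1 / p) / q * S)"
    using \<open>0 < t\<close> \<open>0 \<le> S\<close> \<open>0 < q\<close> \<open>0 < p\<close> by (simp add: powr_mult powr_powr)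
  finally have "K_functional (t powr (1 / p)) f (Lp L (ereal p)) (Lp L \<infinity>) \<le>
      t powr (1 / p) * ((6 powr (1 / p) / q + 1) * S)"
    by (simp add: algebra_simps)
  then have "t powr (- 1 / p) * K_functional (t powr (1 / p)) f (Lp L (ereal p)) (Lp L \<infinity>) \<le>
      t powr (- 1 / p) * (t powr (1 / p) * ((6 powr (1 / p) / q + 1) * S))"
    by (intro mult_left_mono) auto
  also have "\<dots> = (6 powr (1 / p) / q + 1) * S"
    using \<open>0 < t\<close> by (simp flip: mult.assoc powr_add)
  finally show "t powr (- 1 / p) * K_functional (t powr (1 / p)) f (Lp L (ereal p)) (Lp L \<infinity>) \<le>
      (6 powr (1 / p) / q + 1) * S" .
qed

lemma K_functional_Lp_measurable:
  assumes "0 < p" "x \<in> sum_space (Lp L (ereal p)) (Lp L \<infinity>)"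
  shows "(\<lambda>t. t powr (- 1 / p) * K_functional (t powr (1 / p)) x (Lp L (ereal p)) (Lp L \<infinity>))
    \<in> borel_measurable (leb L)"
  using assms by (intro K_functional_measurable Lp_norm_nonneg Lp_top_norm(1) L_pos) auto

text \<open>The rearrangement lies pointwise below the weighted K-functional. As the latter is
  real-valued, this also supplies the finiteness that \<open>carrierI\<close> demands.\<close>

lemma interp_norm_dominates:
  assumes "0 < p" and x: "x \<in> sum_space (Lp L (ereal p)) (Lp L \<infinity>)"
    and finite: "interp_norm \<rho> p p (Lp L (ereal p)) (Lp L \<infinity>) x < \<infinity>"
  shows "x \<in> qcarrier E"
    and "qnorm E x \<le> enn2real (interp_norm \<rho> p p (Lp L (ereal p)) (Lp L \<infinity>) x)"
proof -
  have [measurable]: "x \<in> borel_measurable (leb L)"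
    using x by (auto simp: sum_space_def Lp_def plus_fun_def)
  let ?G = "\<lambda>t. t powr (- 1 / p) * K_functional (t powr (1 / p)) x (Lp L (ereal p)) (Lp L \<infinity>)"
  have le: "rearrangement L x t \<le> ennreal (?G t)" if "t \<in> space (leb L)" for t
    using that by (intro rearrangement_le_K_functional L_pos \<open>0 < p\<close> x) (simp add: space_leb)
  have G_nonneg: "0 \<le> ?G t" for t
    by (intro mult_nonneg_nonneg K_functional_greatest[OF x])
       (auto intro!: add_nonneg_nonneg mult_nonneg_nonneg Lp_norm_nonneg Lp_top_norm(1) L_pos)
  have rr_le: "rr x t \<le> ?G t" if "t \<in> space (leb L)" for t
    unfolding rr_def using le[OF that] G_nonneg[of t] by (intro enn2real_leI) auto
  have rho_le: "\<rho> (\<lambda>t. complex_of_real (rr x t)) \<le> interp_norm \<rho> p p (Lp L (ereal p)) (Lp L \<infinity>) x"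
    unfolding interp_norm_def
  proof (intro rho_mono K_functional_Lp_measurable x \<open>0 < p\<close>)
    show "\<bar>rr x t\<bar> \<le> \<bar>?G t\<bar>" if "t \<in> space (leb L)" for t
      using rr_le[OF that] by simp
  qed measurable
  show x': "x \<in> qcarrier E"
  proof (rule carrierI)
    show "rearrangement L x t < \<infinity>" if "t \<in> space (leb L)" for t
      using le[OF that] by (auto intro: le_less_trans)
    show "\<rho> (\<lambda>t. complex_of_real (rr x t)) < \<infinity>" using rho_le finite by (rule le_less_trans)
  qed measurable
  have "enn2real (ennreal (qnorm E x)) \<le> enn2real (interp_norm \<rho> p p (Lp L (ereal p)) (Lp L \<infinity>) x)"
    using rho_le finite by (intro enn2real_mono) (auto simp: ennreal_qnorm(1)[OF x'])
  then show "qnorm E x \<le> enn2real (interp_norm \<rho> p p (Lp L (ereal p)) (Lp L \<infinity>) x)"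
    using ennreal_qnorm(2)[OF x'] by simp
qed

lemma interp_space_eq:
  obtains p :: real where "0 < p"
    "same_qn_space (interp_space \<rho> p p (Lp L (ereal p)) (Lp L \<infinity>)) E"
proof -
  obtain q M where q: "0 < q" "q < 1" and M: "0 < M"
    and summable: "\<And>f t. f \<in> qcarrier E \<Longrightarrow> t \<in> space (leb L) \<Longrightarrow> summable (\<lambda>k. q ^ k * rr f ((2 / 3) ^ k * t))"
    and rho_series: "\<And>f. f \<in> qcarrier E \<Longrightarrow>
      \<rho> (\<lambda>t. complex_of_real (\<Sum>k. q ^ k * rr f ((2 / 3) ^ k * t))) \<le> ennreal (M * qnorm E f)"
    by (rule dilation_series) blast
  \<comment> \<open>The solution of q^p = 5/6; it is positive because both logarithms are
    negative.\<close>
  define p where "p = ln (5 / 6) / ln q"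
  have p: "0 < p" "q powr p = 5 / 6"
    using q by (auto simp: p_def powr_def divide_neg_neg)
  let ?X = "interp_space \<rho> p p (Lp L (ereal p)) (Lp L \<infinity>)"
  let ?N = "interp_norm \<rho> p p (Lp L (ereal p)) (Lp L \<infinity>)"
  define D where "D = (6 powr (1 / p) / q + 1) * M"
  have "0 < D" using q M by (simp add: D_def add_pos_pos)
  have embed: "f \<in> sum_space (Lp L (ereal p)) (Lp L \<infinity>) \<and> ?N f \<le> ennreal (D * qnorm E f)"
    if f: "f \<in> qcarrier E" for f
  proof
    note [measurable] = carrier_measurable[OF f]
    let ?S = "\<lambda>t. \<Sum>k. q ^ k * rr f ((2 / 3) ^ k * t)"
    have term_le: "q ^ k * rr f ((2 / 3) ^ k * t) \<le> ?S t" if "t \<in> space (leb L)" for k t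
      using sum_le_suminf[OF summable[OF f that], of "{k}"] q by simp
    note K_le = K_functional_le_series[OF f p(1) q(1) p(2) _ term_le]
    \<comment> \<open>Membership in the sum space does not involve \<open>t\<close>, but
      \<open>K_functional_le_series\<close> is stated at a point of (0,L); \<open>s / 2\<close> is
      one.\<close>
    obtain s where "0 < s" "ereal s \<le> L" using pos_ereal_real[OF L_pos zero_less_one] by blast
    then have "s / 2 \<in> space (leb L)" by (auto simp: space_leb intro: less_le_trans[of _ "ereal s"])
    then show f_sum: "f \<in> sum_space (Lp L (ereal p)) (Lp L \<infinity>)" by (intro K_le(1))
    let ?c = "6 powr (1 / p) / q + 1"
    have "0 \<le> ?c" using q by simp
    have S_measurable: "?S \<in> borel_measurable (leb L)"
      by (intro borel_measurable_leb) measurable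
    have "?N f \<le> \<rho> (\<lambda>t. complex_of_real (?c * ?S t))"
      unfolding interp_norm_def
    proof (intro rho_mono K_functional_Lp_measurable f_sum p(1))
      fix t assume t: "t \<in> space (leb L)"
      have "0 \<le> K_functional (t powr (1 / p)) f (Lp L (ereal p)) (Lp L \<infinity>)"
        by (intro K_functional_greatest[OF f_sum])
           (auto intro!: add_nonneg_nonneg mult_nonneg_nonneg Lp_norm_nonneg Lp_top_norm(1) L_pos)
      then show "\<bar>t powr (- 1 / p) * K_functional (t powr (1 / p)) f (Lp L (ereal p)) (Lp L \<infinity>)\<bar> \<le>
          \<bar>?c * ?S t\<bar>"
        using K_le(2)[OF t t] by (intro order_trans[OF _ abs_ge_self]) simp
    qed (use S_measurable in measurable)
    also have "\<dots> = ennreal ?c * \<rho> (\<lambda>t. complex_of_real (?S t))"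
      by (intro rho_scale S_measurable) fact
    also have "\<dots> \<le> ennreal ?c * ennreal (M * qnorm E f)"
      by (intro mult_left_mono rho_series f) auto
    also have "\<dots> = ennreal (D * qnorm E f)"
      using \<open>0 \<le> ?c\<close> by (simp add: D_def mult.assoc flip: ennreal_mult')
    finally show "?N f \<le> ennreal (D * qnorm E f)" .
  qed
  have carrier: "qcarrier ?X = qcarrier E"
  proof (intro equalityI subsetI)
    fix x assume "x \<in> qcarrier ?X"
    then show "x \<in> qcarrier E" by (auto simp: interp_space_def intro: interp_norm_dominates(1)[OF p(1)])
  next
    fix x assume "x \<in> qcarrier E"
    from embed[OF this] show "x \<in> qcarrier ?X" by (auto simp: interp_space_def intro: le_less_trans)
  qed
  have "1 / D * qnorm ?X x \<le> qnorm E x \<and> qnorm E x \<le> 1 * qnorm ?X x" if "x \<in> qcarrier ?X" for x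
  proof
    have x: "x \<in> qcarrier E" using that carrier by simp
    have "qnorm ?X x \<le> D * qnorm E x"
      using embed[OF x] ennreal_qnorm(2)[OF x] \<open>0 < D\<close>
      by (auto simp: interp_space_def intro!: enn2real_leI)
    then show "1 / D * qnorm ?X x \<le> qnorm E x" using \<open>0 < D\<close> by (simp add: field_simps)
    show "qnorm E x \<le> 1 * qnorm ?X x"
      using that interp_norm_dominates(2)[OF p(1)] by (simp add: interp_space_def)
  qed
  then have "same_qn_space ?X E"
    unfolding same_qn_space_def using carrier \<open>0 < D\<close> zero_less_one
    by (intro conjI exI[of _ "1 / D"] exI[of _ 1]) auto
  then show thesis using that p(1) by blast
qed

end

theorem corollary19:
  fixes L :: ereal
    and \<rho> :: "(real \<Rightarrow> complex) \<Rightarrow> ennreal"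
    and E :: "(real \<Rightarrow> complex) qn_space"
  assumes "L \<in> {1, \<infinity>}"
    and "ri_quasi_Banach_space L \<rho> E"
  shows "(\<exists>(p0::real) (p1::ereal) (\<Theta>::real).
            0 < p0 \<and> ereal p0 < p1 \<and> p1 \<le> \<infinity> \<and>
            0 < \<Theta> \<and> 1 / ereal \<Theta> = 1 / ereal p0 - 1 / p1 \<and>
            same_qn_space (interp_space \<rho> \<Theta> p0 (Lp L (ereal p0)) (Lp L p1)) E) \<and>
         (\<exists>p0::real. 0 < p0 \<and>
            same_qn_space (interp_space \<rho> p0 p0 (Lp L (ereal p0)) (Lp L \<infinity>)) E)"
proof -
  interpret ri_space L \<rho> E
    using assms by unfold_locales auto
  obtain p :: real where p: "0 < p" "same_qn_space (interp_space \<rho> p p (Lp L (ereal p)) (Lp L \<infinity>)) E"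
    by (rule interp_space_eq)
  show ?thesis
  proof
    show "\<exists>(p0::real) (p1::ereal) (\<Theta>::real).
            0 < p0 \<and> ereal p0 < p1 \<and> p1 \<le> \<infinity> \<and>
            0 < \<Theta> \<and> 1 / ereal \<Theta> = 1 / ereal p0 - 1 / p1 \<and>
            same_qn_space (interp_space \<rho> \<Theta> p0 (Lp L (ereal p0)) (Lp L p1)) E"
      \<comment> \<open>With p1 = \<infinity> the term 1/p1 is 0 in \<open>ereal\<close>, so
        \<open>p\<close> serves as both p0 and \<Theta>.\<close>
      using p by (intro exI[of _ p] exI[of _ "\<infinity>::ereal"]) auto
    show "\<exists>p0::real. 0 < p0 \<and> same_qn_space (interp_space \<rho> p0 p0 (Lp L (ereal p0)) (Lp L \<infinity>)) E"
      using p by blast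
  qed
qed

end
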